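(* Let $U_1,\ldots,U_n$ be closed linear subspaces of a real Hilbert space $\mathcal H$, $A_i=N_{U_i}$ for $i=1,\ldots,n$, and $U=U_1\cap\cdots\cap U_n$. Let $G=(\mathcal N,\mathcal E)$ be an algorithmic graph of order $n\ge2$, $G'=(\mathcal N,\mathcal E')$ a connected spanning subgraph of $G$, and $Z\in\mathbb R^{n\times(n-1)}$ with $\operatorname{Lap}(G')=ZZ^*$. Let $\theta\in\,]0,2[$, $\boldsymbol w^0\in\mathcal H^n$, $\boldsymbol v^0\in\mathcal H^{n-1}$, and let $(\boldsymbol x^k)$, $(\boldsymbol w^k)$, $(\boldsymbol v^k)$ be generated, for $k=0,1,2,\ldots$, by $$x_i^{k+1}=J_{\frac1{d_i}A_i}\Big(\frac{d_i'}{d_i}w_i^k-\frac1{d_i}\sum_{(i,h)\in\mathcal E'}w_h^k-\frac1{d_i}\sum_{(h,i)\in\mathcal E'}w_h^k+\frac1{d_i}\sum_{j=1}^{n-1}Z_{i,j}v_j^k+\frac2{d_i}\sum_{(h,i)\in\mathcal E}x_h^{k+1}\Big),\quad i=1,\ldots,n,$$ $$w_i^{k+1}=(1-\theta)w_i^k+\theta x_i^{k+1},\quad i=1,\ldots,n,$$ $$v_i^{k+1}=v_i^k+\theta\sum_{j=1}^nZ_{j,i}\big(w_j^k-2x_j^{k+1}\big),\quad i=1,\ldots,n-1.$$ Let $\boldsymbol\alpha=Z^\dagger\boldsymbol\delta$, let $E=Z_\otimes^\dagger(\mathcal U^\perp\cap\Delta_n^\perp)$, and set $$\overline u:=\tfrac1{\|\boldsymbol\alpha\|^2}P_U\big(\boldsymbol\alpha_\otimes^*(Z_\otimes^*\boldsymbol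 w^0+\boldsymbol v^0)\big)=\tfrac1{\|\boldsymbol\alpha\|^2}P_U\big(\boldsymbol\delta_\otimes^*\boldsymbol w^0+\boldsymbol\alpha_\otimes^*\boldsymbol v^0\big),\qquad \overline{\boldsymbol e}:=P_E(Z_\otimes^*\boldsymbol w^0+\boldsymbol v^0).$$ Then: (i) for each $i=1,\ldots,n$, the sequences $(x_i^k)_k$ and $(w_i^k)_k$ converge strongly to $\overline u$; (ii) for each $i=1,\ldots,n-1$, the sequence $(v_i^k)_k$ converges strongly to $\alpha_i\overline u+\overline e_i$.
   Context: $\mathcal H^m$ carries the inner product $\langle\boldsymbol x,\boldsymbol y\rangle=\sum_i\langle x_i,y_i\rangle$. $N_{U_i}(x)=U_i^\perp$ if $x\in U_i$ and $\emptyset$ otherwise (normal cone). $J_A=(\mathrm{Id}+A)^{-1}$ is the resolvent. $P_S$ is the orthogonal projection onto a closed linear subspace $S$. Graphs: an algorithmic graph of order $n\ge2$ is a directed graph $G=(\mathcal N,\mathcal E)$ with $\mathcal N=\{1,\ldots,n\}$, $\mathcal E\subseteq\mathcal N\times\mathcal N$, $(i,j)\in\mathcal E\Rightarrow i<j$, and $G$ connected (ignoring edge directions). $G'$ is a spanning subgraph of $G$ if $\mathcal E'\subseteq\mathcal E$. $d_i^{\rm in}=|\{j:(j,i)\in\mathcal E\}|$, $d_i^{\rm out}=|\{j:(i,j)\in\mathcal E\}|$, $d_i=d_i^{\rm in}+d_i^{\rm out}$ are the degrees in $G$; $d_i'$ denotes the degree of $i$ in $G'$. The Laplacian of a graph is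 the $n\times n$ matrix with the degrees of that graph on the diagonal, $-1$ in entry $(i,j)$ if $i,j$ are adjacent (i.e. $(i,j)$ or $(j,i)$ is an edge), and $0$ otherwise. The degree balance of $G$ is $\boldsymbol\delta\in\mathbb R^n$, $\delta_i=d_i^{\rm out}-d_i^{\rm in}$. Notation: for $K\in\mathbb R^{m\times p}$, $K_\otimes:\mathcal H^p\to\mathcal H^m$, $(K_\otimes\boldsymbol x)_i=\sum_jK_{i,j}x_j$; for $\boldsymbol\beta\in\mathbb R^m$, $\boldsymbol\beta_\otimes x=(\beta_1x,\ldots,\beta_mx)$ and $\boldsymbol\beta_\otimes^*\boldsymbol v=\sum_j\beta_jv_j$. $Z^\dagger$ is the Moore--Penrose inverse and $Z_\otimes^\dagger=(Z^\dagger)_\otimes$. $\Delta_n=\{(x,\ldots,x)\in\mathcal H^n\mid x\in\mathcal H\}$, $\mathcal U=U_1\times\cdots\times U_n\subseteq\mathcal H^n$. $E$ is a closed linear subspace of $\mathcal H^{n-1}$ and $\boldsymbol\alpha\neq0$. *)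

theory Defs
  imports "HOL-Analysis.Analysis"
begin

text \<open>
  The node set \<open>{1, \<dots>, n}\<close> is a finite linearly ordered type \<open>'n\<close> with \<open>n = CARD('n)\<close>, and
  \<open>\<H>\<^sup>n\<close> is the type \<open>'a ^ 'n\<close>, whose library inner product is the sum of the componentwise ones.
\<close>


section \<open>Algorithmic graphs\<close>

text \<open>A graph on the node set \<open>UNIV :: 'n set\<close> is given by its set of directed edges.\<close>

definition connected_graph :: "('n \<times> 'n) set \<Rightarrow> bool" where
  "connected_graph G \<longleftrightarrow> (\<forall>i j. (i, j) \<in> (G \<union> G\<inverse>)\<^sup>*)"

definition algorithmic_graph :: "('n::{finite,linorder} \<times> 'n) set \<Rightarrow> bool" where
  "algorithmic_graph G \<longleftrightarrow>
     CARD('n) \<ge> 2 \<and> (\<forall>i j. (i, j) \<in> G \<longrightarrow> i < j) \<and> connected_graph G"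

definition indeg :: "('n \<times> 'n) set \<Rightarrow> 'n \<Rightarrow> nat" where
  "indeg G i = card {j. (j, i) \<in> G}"

definition outdeg :: "('n \<times> 'n) set \<Rightarrow> 'n \<Rightarrow> nat" where
  "outdeg G i = card {j. (i, j) \<in> G}"

definition deg :: "('n \<times> 'n) set \<Rightarrow> 'n \<Rightarrow> nat" where
  "deg G i = indeg G i + outdeg G i"

definition Lap :: "('n::finite \<times> 'n) set \<Rightarrow> real ^ 'n ^ 'n" where
  "Lap G = (\<chi> i j. if i = j then real (deg G i)
                   else if (i, j) \<in> G \<or> (j, i) \<in> G then - 1 else 0)"

definition degree_balance :: "('n::finite \<times> 'n) set \<Rightarrow> real ^ 'n" where
  "degree_balance G = (\<chi> i. real (outdeg G i) - real (indeg G i))"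


section \<open>Matrices and vectors acting on product spaces\<close>

definition tensor_op :: "real ^ 'p ^ 'm \<Rightarrow> ('a::real_vector) ^ 'p \<Rightarrow> 'a ^ 'm" where
  "tensor_op K x = (\<chi> i. \<Sum>j\<in>UNIV. (K $ i $ j) *\<^sub>R (x $ j))"

text \<open>\<open>\<beta>\<^sub>\<otimes>\<^sup>*\<close>, the adjoint of \<open>x \<mapsto> (\<beta>\<^sub>1 x, \<dots>, \<beta>\<^sub>m x)\<close>.\<close>

definition tensor_adj :: "real ^ 'm \<Rightarrow> ('a::real_vector) ^ 'm \<Rightarrow> 'a" where
  "tensor_adj \<beta> v = (\<Sum>j\<in>UNIV. (\<beta> $ j) *\<^sub>R (v $ j))"

text \<open>The Moore--Penrose inverse is the unique matrix satisfying the four Penrose equations.\<close>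

definition moore_penrose :: "real ^ 'm ^ 'n \<Rightarrow> real ^ 'n ^ 'm" where
  "moore_penrose Z = (THE X. Z ** X ** Z = Z \<and> X ** Z ** X = X \<and>
      transpose (Z ** X) = Z ** X \<and> transpose (X ** Z) = X ** Z)"

definition product_set :: "('n \<Rightarrow> 'a set) \<Rightarrow> ('a ^ 'n) set" where
  "product_set U = {u. \<forall>i. u $ i \<in> U i}"

definition diagonal :: "('a ^ 'n) set" where
  "diagonal = {\<chi> i. x | x. True}"


section \<open>Projections and set-valued operators\<close>

text \<open>
  The library's \<^const>\<open>closest_point\<close> is restricted to Heine--Borel spaces, hence to finite
  dimension.
\<close>

definition orth_proj :: "'a::real_inner set \<Rightarrow> 'a \<Rightarrow> 'a" where
  "orth_proj S x = (THE p. p \<in> S \<and> x - p \<in> S\<^sup>\<bottom>)"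

text \<open>The normal cone of a linear subspace.\<close>

definition normal_cone :: "'a::real_inner set \<Rightarrow> 'a \<Rightarrow> 'a set" where
  "normal_cone S x = (if x \<in> S then S\<^sup>\<bottom> else {})"

definition scale_op :: "real \<Rightarrow> ('a::real_vector \<Rightarrow> 'a set) \<Rightarrow> 'a \<Rightarrow> 'a set" where
  "scale_op c A x = (\<lambda>u. c *\<^sub>R u) ` A x"

text \<open>
  \<open>(Id + A)\<^sup>-\<^sup>1\<close> as a set-valued operator; for maximally monotone \<open>A\<close> its values are singletons, and
  \<open>x = J\<^sub>A y\<close> is then expressed by \<open>resolvent A y = {x}\<close>.
\<close>

definition resolvent :: "('a::real_vector \<Rightarrow> 'a set) \<Rightarrow> 'a \<Rightarrow> 'a set" where
  "resolvent A y = {x. y \<in> (\<lambda>u. x + u) ` A x}"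

end

theory Submission
  imports Defs
begin

text \<open>
  Put \<open>s\<^sup>k = Z\<^sup>* w\<^sup>k + v\<^sup>k\<close>. Since \<open>Z Z\<^sup>*\<close> is the Laplacian of \<open>G'\<close>, the argument of the resolvents depends
  on \<open>w\<^sup>k\<close> and \<open>v\<^sup>k\<close> only through \<open>Z s\<^sup>k\<close>, and the updates of \<open>w\<close> and \<open>v\<close> combine to
  \<open>s\<^sup>k\<^sup>+\<^sup>1 = T s\<^sup>k\<close> with \<open>T s = s - \<theta> Z\<^sup>* x(s)\<close>. Here \<open>x(s)\<close> is the result of one sweep through the nodes, the
  unique \<open>x \<in> \<U>\<close> with \<open>Z s - (D - 2N) x \<in> \<U>\<^sup>\<bottom>\<close>; \<open>D\<close> is the diagonal matrix of the degrees of \<open>G\<close> and \<open>N\<close>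
  is strictly lower triangular with a \<open>1\<close> for each edge. As the resolvents of normal cones of subspaces
  are orthogonal projections, \<open>T\<close> is linear.

  The symmetric part of \<open>D - 2N\<close> is the Laplacian of \<open>G\<close>. Therefore \<open>\<langle>s, Z\<^sup>* x(s)\<rangle>\<close> is the Dirichlet energy
  of \<open>x(s)\<close> in \<open>G\<close>, which dominates its energy \<open>\<parallel>Z\<^sup>* x(s)\<parallel>\<^sup>2\<close> in the subgraph \<open>G'\<close>; this makes \<open>T\<close> averaged
  for \<open>0 < \<theta> < 2\<close> (\<open>averaged_T\<close>). The powers of an averaged linear map converge strongly to the
  projection onto its fixed points (\<open>averaged_powers_tendsto\<close>), because they annihilate the closure of the range
  of \<open>Id - T\<close> in the limit and the orthogonal complement of that range is fixed.

  A vector \<open>s\<close> is fixed iff \<open>Z\<^sup>* x(s) = 0\<close>, that is, iff \<open>x(s)\<close> is constant. The row sums of \<open>D - 2N\<close> form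
  the degree balance \<open>\<delta> = Z \<alpha>\<close>, and from this the fixed points are the orthogonal sum of \<open>\<alpha>\<^sub>\<otimes> U\<close> and \<open>E\<close>
  (\<open>fixed_point_decomposition\<close>, \<open>E_orthogonal_scaled\<close>). So \<open>s\<^sup>k\<close> converges to \<open>\<alpha>\<^sub>\<otimes> u + e\<close>, with \<open>u\<close> and
  \<open>e\<close> as in the theorem. The remaining limits follow: \<open>x\<^sup>k\<^sup>+\<^sup>1 = x(s\<^sup>k)\<close> by continuity of the sweep,
  \<open>w\<^sup>k\<close> because its recurrence is driven by \<open>x\<^sup>k\<close> and contracts by \<open>\<bar>1 - \<theta>\<bar> < 1\<close>, and \<open>v\<^sup>k = s\<^sup>k - Z\<^sup>* w\<^sup>k\<close> because \<open>Z\<^sup>*\<close> vanishes on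
  constant vectors.
\<close>

section \<open>Orthogonal projections in Hilbert space\<close>

lemma orthogonal_compI: "(\<And>y. y \<in> S \<Longrightarrow> inner y x = 0) \<Longrightarrow> x \<in> S\<^sup>\<bottom>"
  by (simp add: orthogonal_comp_def orthogonal_def)

lemma orthogonal_compD: "x \<in> S\<^sup>\<bottom> \<Longrightarrow> y \<in> S \<Longrightarrow> inner y x = 0"
  by (simp add: orthogonal_comp_def orthogonal_def)

lemma closed_orthogonal_comp: "closed (S\<^sup>\<bottom>)" for S :: "'b::real_inner set"
proof -
  have "S\<^sup>\<bottom> = (\<Inter>y\<in>S. {x. inner y x = 0})"
    by (auto simp: orthogonal_comp_def orthogonal_def)
  then show ?thesis
    by (auto intro!: closed_INT closed_Collect_eq continuous_intros)
qed

lemma subspace_closure: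
  fixes S :: "'a::real_normed_vector set"
  assumes S: "subspace S"
  shows "subspace (closure S)"
  unfolding subspace_def
proof (intro conjI ballI allI)
  show "0 \<in> closure S"
    using subspace_0[OF S] closure_subset by blast
next
  fix x y assume "x \<in> closure S" "y \<in> closure S"
  then obtain f g where "\<And>n. f n \<in> S" "f \<longlonglongrightarrow> x" "\<And>n. g n \<in> S" "g \<longlonglongrightarrow> y"
    unfolding closure_sequential by metis
  then show "x + y \<in> closure S"
    unfolding closure_sequential
    by (intro exI[of _ "\<lambda>n. f n + g n"]) (auto intro: tendsto_add subspace_add[OF S])
next
  fix c x assume "x \<in> closure S"
  then obtain f where "\<And>n. f n \<in> S" "f \<longlonglongrightarrow> x"
    unfolding closure_sequential by metis
  then show "c *\<^sub>R x \<in> closure S"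
    unfolding closure_sequential
    by (intro exI[of _ "\<lambda>n. c *\<^sub>R f n"]) (auto intro!: tendsto_intros subspace_scale[OF S])
qed

text \<open>
  The first-order optimality argument for the projection: near \<open>t = 0\<close> the linear term dominates, so
  a nonzero \<open>a\<close> would make the expression negative at the minimiser of \<open>t a + t\<^sup>2 (\<bar>b\<bar> + 1)\<close>.
\<close>
lemma linear_coefficient_eq_0:
  fixes a b :: real
  assumes "\<And>t. 0 \<le> t * a + t\<^sup>2 * b"
  shows "a = 0"
proof (rule ccontr)
  assume "a \<noteq> 0"
  define B where "B = \<bar>b\<bar> + 1"
  define t where "t = - a / (2 * B)"
  have B: "0 < B" "b \<le> B"
    by (auto simp: B_def)
  have "t * a + t\<^sup>2 * b \<le> t * a + t\<^sup>2 * B"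
    using B by (intro add_left_mono mult_left_mono) auto
  also have "\<dots> = - a\<^sup>2 / (4 * B)"
    unfolding t_def using B by (simp add: field_simps power2_eq_square)
  also have "\<dots> < 0"
    using \<open>a \<noteq> 0\<close> B by (simp add: divide_less_0_iff)
  finally show False
    using assms[of t] by simp
qed

text \<open>
  Hilbert's projection theorem. By the parallelogram law every sequence in \<open>S\<close> that minimises the
  distance to \<open>x\<close> is Cauchy, and \<open>x - p\<close> is orthogonal to \<open>S\<close> when \<open>p\<close> is its limit, because no step
  along \<open>S\<close> brings \<open>p\<close> closer to \<open>x\<close>.
\<close>
lemma orthogonal_decomposition:
  fixes S :: "'a::{real_inner,complete_space} set"
  assumes S: "subspace S" and cl: "closed S"
  obtains p where "p \<in> S" "x - p \<in> S\<^sup>\<bottom>"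
proof -
  define D where "D = (INF y\<in>S. (norm (x - y))\<^sup>2)"
  have bdd: "bdd_below ((\<lambda>y. (norm (x - y))\<^sup>2) ` S)"
    by (rule bdd_belowI2[of _ 0]) simp
  have ne: "S \<noteq> {}"
    using subspace_0[OF S] by blast
  have D_le: "D \<le> (norm (x - y))\<^sup>2" if "y \<in> S" for y
    unfolding D_def using bdd that by (rule cINF_lower)
  have "\<exists>y\<in>S. (norm (x - y))\<^sup>2 < D + 1 / Suc n" for n
    using cINF_less_iff[of S "\<lambda>y. (norm (x - y))\<^sup>2" "D + 1 / Suc n"] ne bdd
    unfolding D_def by simp
  then obtain p where pS: "\<And>n. p n \<in> S"
    and p_le: "\<And>n. (norm (x - p n))\<^sup>2 < D + 1 / Suc n"
    by metis
  \<comment> \<open>Parallelogram law; the midpoint lies in \<open>S\<close> and so is at squared distance at least \<open>D\<close>.\<close>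
  have p_dist: "(norm (p m - p n))\<^sup>2 \<le> 2 / Suc m + 2 / Suc n" for m n
  proof -
    have "(1/2) *\<^sub>R (p m + p n) \<in> S"
      using S pS by (simp add: subspace_add subspace_scale)
    then have "D \<le> (norm (x - (1/2) *\<^sub>R (p m + p n)))\<^sup>2"
      by (rule D_le)
    moreover have "(norm (p m - p n))\<^sup>2 = 2 * (norm (x - p m))\<^sup>2 + 2 * (norm (x - p n))\<^sup>2
        - 4 * (norm (x - (1/2) *\<^sub>R (p m + p n)))\<^sup>2"
      by (simp add: power2_norm_eq_inner inner_diff inner_add inner_commute algebra_simps)
    ultimately show ?thesis
      using p_le[of m] p_le[of n] by simp
  qed
  have "Cauchy p"
  proof (rule metric_CauchyI)
    fix e :: real assume "0 < e"
    then obtain N where N: "4 / e\<^sup>2 < real N"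
      using reals_Archimedean2 by blast
    have "dist (p m) (p n) < e" if "N \<le> m" "N \<le> n" for m n
    proof -
      have N0: "0 < real N"
        using N \<open>0 < e\<close> by (meson divide_nonneg_nonneg le_less_trans less_imp_le zero_le_numeral zero_le_power2)
      have "2 / real (Suc m) \<le> 2 / N" "2 / real (Suc n) \<le> 2 / N"
        using that N0 by (auto intro!: divide_left_mono)
      then have "(norm (p m - p n))\<^sup>2 \<le> 4 / N"
        using p_dist[of m n] by simp
      also have "\<dots> < e\<^sup>2"
        using N N0 \<open>0 < e\<close> by (simp add: field_simps)
      finally show ?thesis
        using \<open>0 < e\<close> by (simp add: dist_norm power_less_imp_less_base)
    qed
    then show "\<exists>M. \<forall>m\<ge>M. \<forall>n\<ge>M. dist (p m) (p n) < e"
      by blast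
  qed
  then obtain q where q: "p \<longlonglongrightarrow> q"
    by (auto simp: Cauchy_convergent_iff convergent_def)
  have qS: "q \<in> S"
    using closed_sequentially[OF cl] pS q by blast
  have "(\<lambda>n. D + 1 / real (Suc n)) \<longlonglongrightarrow> D + 0"
    by (intro tendsto_intros LIMSEQ_Suc lim_1_over_n)
  moreover have "(\<lambda>n. (norm (x - p n))\<^sup>2) \<longlonglongrightarrow> (norm (x - q))\<^sup>2"
    by (intro tendsto_intros q)
  ultimately have q_min: "(norm (x - q))\<^sup>2 \<le> D"
    using p_le by (intro LIMSEQ_le[of _ _ "\<lambda>n. D + 1 / real (Suc n)"]) (auto intro: less_imp_le)
  have "x - q \<in> S\<^sup>\<bottom>"
    unfolding orthogonal_comp_def orthogonal_def
  proof (intro CollectI ballI)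
    fix y assume y: "y \<in> S"
    have "0 \<le> t * (2 * inner y (x - q)) + t\<^sup>2 * (norm y)\<^sup>2" for t
    proof -
      have "q - t *\<^sub>R y \<in> S"
        using S qS y by (simp add: subspace_diff subspace_scale)
      then have "(norm (x - q))\<^sup>2 \<le> (norm (x - (q - t *\<^sub>R y)))\<^sup>2"
        using q_min D_le order_trans by blast
      also have "\<dots> = (norm (x - q))\<^sup>2 + (t * (2 * inner y (x - q)) + t\<^sup>2 * (norm y)\<^sup>2)"
        unfolding power2_norm_eq_inner power2_eq_square[of t]
        by (simp add: inner_diff_left inner_diff_right inner_add_left inner_add_right inner_commute
            algebra_simps)
      finally show ?thesis by simp
    qed
    then show "inner y (x - q) = 0"
      using linear_coefficient_eq_0 by fastforce
  qed
  with qS show thesis by (rule that)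
qed

lemma orth_proj_eqI:
  assumes S: "subspace S" and p: "p \<in> S" "x - p \<in> S\<^sup>\<bottom>"
  shows "orth_proj S x = p"
  unfolding orth_proj_def
proof (rule the_equality)
  fix q assume q: "q \<in> S \<and> x - q \<in> S\<^sup>\<bottom>"
  then have "(x - p) - (x - q) \<in> S\<^sup>\<bottom>" "q - p \<in> S"
    using S p by (blast intro: subspace_diff subspace_orthogonal_comp)+
  then have "inner (q - p) (q - p) = 0"
    by (auto simp: orthogonal_comp_def orthogonal_def)
  then show "q = p"
    by simp
qed (use p in simp)

lemma orth_proj_works:
  fixes S :: "'a::{real_inner,complete_space} set"
  assumes "subspace S" "closed S"
  shows "orth_proj S x \<in> S" "x - orth_proj S x \<in> S\<^sup>\<bottom>"
  using orthogonal_decomposition[OF assms, of x] orth_proj_eqI[OF assms(1)] by metis+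

section \<open>Powers of averaged linear maps\<close>

text \<open>
  With \<open>c = (1 - a) / a\<close> these are the \<open>a\<close>-averaged maps of fixed-point theory, the inequality being
  stated with \<open>0\<close> as one of the two points, which is the general case for linear maps.
\<close>
definition averaged :: "real \<Rightarrow> ('a::real_inner \<Rightarrow> 'a) \<Rightarrow> bool" where
  "averaged c T \<longleftrightarrow> (\<forall>u. c * (norm (u - T u))\<^sup>2 \<le> (norm u)\<^sup>2 - (norm (T u))\<^sup>2)"

text \<open>The squared displacements telescope against \<open>\<parallel>T\<^sup>k u\<parallel>\<^sup>2\<close>, which decreases to a limit.\<close>
lemma averaged_asymptotically_regular:
  assumes c: "0 < c" and T: "averaged c T"
  shows "(\<lambda>k. (T ^^ k) u - (T ^^ Suc k) u) \<longlonglongrightarrow> 0"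
proof -
  define a where "a k = (norm ((T ^^ k) u))\<^sup>2" for k
  have step: "c * (norm ((T ^^ k) u - (T ^^ Suc k) u))\<^sup>2 \<le> a k - a (Suc k)" for k
    using T by (simp add: a_def averaged_def)
  have "decseq a"
  proof (rule decseq_SucI)
    show "a (Suc k) \<le> a k" for k
      using step[of k] c by (smt (verit) mult_nonneg_nonneg zero_le_power2)
  qed
  then obtain L where L: "a \<longlonglongrightarrow> L"
    using decseq_convergent[of a 0] by (auto simp: a_def)
  have "(\<lambda>k. (a k - a (Suc k)) / c) \<longlonglongrightarrow> (L - L) / c"
    using L c by (intro tendsto_intros LIMSEQ_Suc) auto
  then have "(\<lambda>k. (a k - a (Suc k)) / c) \<longlonglongrightarrow> 0"
    by simp
  then have "(\<lambda>k. (norm ((T ^^ k) u - (T ^^ Suc k) u))\<^sup>2) \<longlonglongrightarrow> 0"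
  proof (rule tendsto_sandwich[OF _ _ tendsto_const, rotated 2])
    show "\<forall>\<^sub>F k in sequentially. (norm ((T ^^ k) u - (T ^^ Suc k) u))\<^sup>2 \<le> (a k - a (Suc k)) / c"
      using step c by (intro always_eventually allI) (simp only: pos_le_divide_eq mult.commute)
  qed simp_all
  then have "(\<lambda>k. sqrt ((norm ((T ^^ k) u - (T ^^ Suc k) u))\<^sup>2)) \<longlonglongrightarrow> sqrt 0"
    by (intro tendsto_intros)
  then show ?thesis
    by (simp add: tendsto_norm_zero_iff del: funpow.simps)
qed

text \<open>
  The powers send \<open>u - T u\<close> to \<open>0\<close>, hence also every vector of the closure \<open>V\<close> of the range of
  \<open>Id - T\<close>, since they are nonexpansive. The component \<open>r\<close> of \<open>s - q\<close> orthogonal to \<open>V\<close> is a fixed point,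
  because \<open>\<langle>r - T r, r\<rangle> = 0\<close> and \<open>\<parallel>T r\<parallel> \<le> \<parallel>r\<parallel>\<close> force \<open>T r = r\<close>; the hypothesis on \<open>q\<close>, which says that \<open>q\<close>
  is the projection of \<open>s\<close> onto the fixed points, then gives \<open>r = 0\<close>.
\<close>
lemma averaged_powers_tendsto:
  fixes T :: "'a::{real_inner,complete_space} \<Rightarrow> 'a"
  assumes lin: "linear T" and c: "0 < c" and av: "averaged c T"
    and q: "T q = q" and orth: "\<And>f. T f = f \<Longrightarrow> inner (s - q) f = 0"
  shows "(\<lambda>k. (T ^^ k) s) \<longlonglongrightarrow> q"
proof -
  define V where "V = closure (range (\<lambda>u. u - T u))"
  have "linear (\<lambda>u. u - T u)"
    using lin by (simp add: linear_compose_sub linear_ident)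
  then have V: "subspace V" "closed V"
    unfolding V_def by (auto intro!: subspace_closure linear_subspace_image)
  obtain p where p: "p \<in> V" "s - q - p \<in> V\<^sup>\<bottom>"
    using orthogonal_decomposition[OF V] by blast
  define r where "r = s - q - p"
  have nonexp: "norm (T u) \<le> norm u" for u
  proof -
    have "0 \<le> c * (norm (u - T u))\<^sup>2"
      using c by simp
    also have "\<dots> \<le> (norm u)\<^sup>2 - (norm (T u))\<^sup>2"
      using av by (simp add: averaged_def)
    finally show ?thesis
      by (intro power2_le_imp_le[OF _ norm_ge_zero]) simp
  qed
  have "r - T r \<in> V"
    unfolding V_def by (intro subsetD[OF closure_subset] rangeI)
  then have "inner (r - T r) r = 0"
    using p(2) by (auto simp: r_def orthogonal_comp_def orthogonal_def)
  then have "(norm (r - T r))\<^sup>2 = (norm (T r))\<^sup>2 - (norm r)\<^sup>2"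
    by (simp add: power2_norm_eq_inner inner_diff inner_commute)
  also have "\<dots> \<le> 0"
    using nonexp[of r] by (simp add: power_mono)
  finally have "T r = r"
    by simp
  then have "inner (s - q) r = 0"
    by (rule orth)
  moreover have "inner p r = 0"
    using p by (auto simp: r_def orthogonal_comp_def orthogonal_def)
  moreover have "s - q = p + r"
    by (simp add: r_def)
  ultimately have "r = 0"
    by (simp add: inner_add_left)
  then have sqV: "s - q \<in> V"
    using p by (simp add: r_def)
  have linpow: "linear (T ^^ k)" for k
    by (induction k) (use lin in \<open>auto intro: linear_compose linear_ident simp: id_def simp del: o_apply\<close>)
  have nonexp_pow: "norm ((T ^^ k) u) \<le> norm u" for k u
    by (induction k) (auto intro: order_trans[OF nonexp])
  have q_pow: "(T ^^ k) q = q" for k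
    by (induction k) (auto simp: q)
  have "(\<lambda>k. (T ^^ k) (s - q)) \<longlonglongrightarrow> 0"
  proof (rule metric_LIMSEQ_I)
    fix e :: real assume "0 < e"
    then obtain u where u: "dist (u - T u) (s - q) < e / 2"
      using sqV unfolding V_def closure_approachable by (auto dest!: spec[of _ "e / 2"])
    have "(\<lambda>k. (T ^^ k) u - (T ^^ Suc k) u) \<longlonglongrightarrow> 0"
      using c av by (rule averaged_asymptotically_regular)
    then obtain N where N: "\<And>k. k \<ge> N \<Longrightarrow> norm ((T ^^ k) u - (T ^^ Suc k) u) < e / 2"
      using \<open>0 < e\<close> unfolding LIMSEQ_iff by (metis diff_zero half_gt_zero)
    have "norm ((T ^^ k) (s - q)) < e" if "k \<ge> N" for k
    proof -
      have "(T ^^ k) (s - q) = (T ^^ k) (s - q - (u - T u)) + ((T ^^ k) u - (T ^^ Suc k) u)"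
        by (simp add: linear_diff[OF linpow] funpow_swap1)
      then have "norm ((T ^^ k) (s - q))
          \<le> norm ((T ^^ k) (s - q - (u - T u))) + norm ((T ^^ k) u - (T ^^ Suc k) u)"
        using norm_triangle_ineq by metis
      also have "\<dots> < e / 2 + e / 2"
        using nonexp_pow[of k "s - q - (u - T u)"] u N[OF that]
        by (intro add_strict_mono) (auto simp: dist_norm norm_minus_commute)
      finally show ?thesis by simp
    qed
    then show "\<exists>N. \<forall>k\<ge>N. dist ((T ^^ k) (s - q)) 0 < e"
      by auto
  qed
  then show ?thesis
    by (simp add: linear_diff[OF linpow] q_pow LIM_zero_iff)
qed

text \<open>
  Once the perturbations are below \<open>\<eta> = (1 - \<bar>c\<bar>) \<epsilon> / 2\<close>, the sequence contracts geometrically towards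
  the ball of radius \<open>\<epsilon> / 2\<close>.
\<close>
lemma contraction_recurrence_tendsto_0:
  fixes r e :: "nat \<Rightarrow> 'a::real_normed_vector"
  assumes rec: "\<And>k. r (Suc k) = c *\<^sub>R r k + e k" and c: "\<bar>c\<bar> < 1" and e: "e \<longlonglongrightarrow> 0"
  shows "r \<longlonglongrightarrow> 0"
proof (rule metric_LIMSEQ_I)
  fix \<epsilon> :: real assume \<epsilon>: "0 < \<epsilon>"
  define \<eta> where "\<eta> = (1 - \<bar>c\<bar>) * (\<epsilon> / 2)"
  have "0 < \<eta>"
    using c \<epsilon> by (simp add: \<eta>_def)
  then obtain N where N: "\<And>k. k \<ge> N \<Longrightarrow> norm (e k) < \<eta>"
    using e by (auto simp: LIMSEQ_iff)
  have bound: "norm (r (j + N)) \<le> \<bar>c\<bar> ^ j * norm (r N) + \<epsilon> / 2" for j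
  proof (induction j)
    case 0
    then show ?case using \<epsilon> by simp
  next
    case (Suc j)
    have \<eta>: "\<eta> = \<epsilon> / 2 - \<bar>c\<bar> * (\<epsilon> / 2)"
      by (simp add: \<eta>_def left_diff_distrib)
    have "norm (r (Suc j + N)) \<le> \<bar>c\<bar> * norm (r (j + N)) + norm (e (j + N))"
      using rec[of "j + N"] norm_triangle_ineq[of "c *\<^sub>R r (j + N)" "e (j + N)"] by simp
    also have "\<dots> \<le> \<bar>c\<bar> * (\<bar>c\<bar> ^ j * norm (r N) + \<epsilon> / 2) + \<eta>"
      using Suc N[of "j + N"] by (intro add_mono mult_left_mono) auto
    also have "\<dots> = \<bar>c\<bar> ^ Suc j * norm (r N) + \<epsilon> / 2"
      by (simp add: \<eta> distrib_left)
    finally show ?case .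
  qed
  have "(\<lambda>j. \<bar>c\<bar> ^ j * norm (r N)) \<longlonglongrightarrow> 0 * norm (r N)"
    using c by (intro tendsto_intros LIMSEQ_realpow_zero) auto
  then obtain M where M: "\<And>j. j \<ge> M \<Longrightarrow> \<bar>c\<bar> ^ j * norm (r N) < \<epsilon> / 2"
    using \<epsilon> order_tendstoD(2)[of _ 0 sequentially "\<epsilon> / 2"]
    unfolding eventually_sequentially by fastforce
  have "norm (r k) < \<epsilon>" if "k \<ge> M + N" for k
  proof -
    have "norm (r k) \<le> \<bar>c\<bar> ^ (k - N) * norm (r N) + \<epsilon> / 2"
      using bound[of "k - N"] that by simp
    also have "\<dots> < \<epsilon> / 2 + \<epsilon> / 2"
    proof (rule add_strict_right_mono)
      have "M \<le> k - N"
        using that by linarith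
      then show "\<bar>c\<bar> ^ (k - N) * norm (r N) < \<epsilon> / 2"
        by (rule M)
    qed
    finally show ?thesis
      by simp
  qed
  then show "\<exists>N. \<forall>k\<ge>N. dist (r k) 0 < \<epsilon>"
    by auto
qed

section \<open>Operators on product spaces\<close>

lemma inner_single_component:
  fixes y :: "('a::real_inner) ^ 'n::finite"
  shows "inner (\<chi> j. if j = i then u else 0) y = inner u (y $ i)"
  unfolding inner_vec_def by (simp add: if_distrib[of "\<lambda>z. inner z _"] cong: if_cong)

lemma orthogonal_comp_product_set:
  fixes U :: "'n::finite \<Rightarrow> 'a::real_inner set"
  assumes "\<And>i. 0 \<in> U i"
  shows "(product_set U)\<^sup>\<bottom> = product_set (\<lambda>i. (U i)\<^sup>\<bottom>)"
proof (intro equalityI subsetI)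
  fix y assume y: "y \<in> (product_set U)\<^sup>\<bottom>"
  have "inner u (y $ i) = 0" if "u \<in> U i" for u i
  proof -
    have "(\<chi> j. if j = i then u else 0) \<in> product_set U"
      using assms that by (simp add: product_set_def)
    from orthogonal_compD[OF y this] show ?thesis
      by (simp add: inner_single_component)
  qed
  then show "y \<in> product_set (\<lambda>i. (U i)\<^sup>\<bottom>)"
    by (auto simp: product_set_def intro: orthogonal_compI)
next
  fix y assume y: "y \<in> product_set (\<lambda>i. (U i)\<^sup>\<bottom>)"
  show "y \<in> (product_set U)\<^sup>\<bottom>"
  proof (rule orthogonal_compI)
    fix u assume "u \<in> product_set U"
    then have "inner (u $ i) (y $ i) = 0" for i
      using y by (intro orthogonal_compD[of _ "U i"]) (simp_all add: product_set_def)
    then show "inner u y = 0"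
      by (simp add: inner_vec_def)
  qed
qed

lemma orthogonal_comp_diagonal:
  "(diagonal :: ('a::real_inner ^ 'n::finite) set)\<^sup>\<bottom> = {y. (\<Sum>i\<in>UNIV. y $ i) = 0}"
proof -
  have eq: "inner (\<chi> i. x) y = inner x (\<Sum>i\<in>UNIV. y $ i)" for x :: 'a and y :: "'a ^ 'n"
    by (simp add: inner_vec_def inner_sum_right)
  show ?thesis
  proof (intro equalityI subsetI)
    fix y :: "'a ^ 'n" assume "y \<in> diagonal\<^sup>\<bottom>"
    then have "inner (\<chi> i. \<Sum>i\<in>UNIV. y $ i) y = 0"
      by (rule orthogonal_compD) (auto simp: diagonal_def)
    then show "y \<in> {y. (\<Sum>i\<in>UNIV. y $ i) = 0}"
      by (simp add: eq)
  qed (auto simp: diagonal_def eq intro!: orthogonal_compI)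
qed

lemma tensor_op_nth [simp]: "tensor_op K x $ i = (\<Sum>j\<in>UNIV. (K $ i $ j) *\<^sub>R (x $ j))"
  by (simp add: tensor_op_def)

lemma linear_tensor_op: "linear (tensor_op K)"
  by (rule linearI) (simp_all add: vec_eq_iff scaleR_add_right sum.distrib scaleR_right.sum mult.commute)

lemma tensor_op_matrix_mult:
  "tensor_op (A ** B) x = tensor_op A (tensor_op B x)"
proof -
  have "(\<Sum>j\<in>UNIV. (\<Sum>k\<in>UNIV. A $ i $ k * B $ k $ j) *\<^sub>R x $ j)
      = (\<Sum>k\<in>UNIV. A $ i $ k *\<^sub>R (\<Sum>j\<in>UNIV. B $ k $ j *\<^sub>R x $ j))" for i
  proof -
    have "(\<Sum>j\<in>UNIV. (\<Sum>k\<in>UNIV. A $ i $ k * B $ k $ j) *\<^sub>R x $ j)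
        = (\<Sum>j\<in>UNIV. \<Sum>k\<in>UNIV. (A $ i $ k * B $ k $ j) *\<^sub>R x $ j)"
      by (simp add: scaleR_sum_left)
    also have "\<dots> = (\<Sum>k\<in>UNIV. \<Sum>j\<in>UNIV. (A $ i $ k * B $ k $ j) *\<^sub>R x $ j)"
      by (rule sum.swap)
    finally show ?thesis
      by (simp add: scaleR_sum_right)
  qed
  then show ?thesis
    by (simp add: vec_eq_iff matrix_matrix_mult_def)
qed

lemma tensor_op_mat_1: "tensor_op (mat 1) x = x"
  by (simp add: vec_eq_iff mat_def if_distrib[of "\<lambda>c. c *\<^sub>R _"] cong: if_cong)

lemma tensor_op_scaled_vector:
  "tensor_op K (\<chi> j. (b $ j) *\<^sub>R u) = (\<chi> i. ((K *v b) $ i) *\<^sub>R u)"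
  by (simp add: vec_eq_iff matrix_vector_mult_def scaleR_sum_left)

lemma inner_tensor_op:
  fixes x :: "'a::real_inner ^ 'p::finite"
  shows "inner (tensor_op K x) y = inner x (tensor_op (transpose K) y)"
proof -
  have "inner (tensor_op K x) y = (\<Sum>i\<in>UNIV. \<Sum>j\<in>UNIV. K $ i $ j * inner (x $ j) (y $ i))"
    by (simp add: inner_vec_def inner_sum_left)
  also have "\<dots> = (\<Sum>j\<in>UNIV. \<Sum>i\<in>UNIV. K $ i $ j * inner (x $ j) (y $ i))"
    by (rule sum.swap)
  also have "\<dots> = inner x (tensor_op (transpose K) y)"
    by (simp add: inner_vec_def inner_sum_right transpose_def)
  finally show ?thesis .
qed

lemma inner_tensor_adj:
  fixes v :: "'a::real_inner ^ 'm::finite"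
  shows "inner (\<chi> j. (b $ j) *\<^sub>R u) v = inner u (tensor_adj b v)"
  by (simp add: inner_vec_def tensor_adj_def inner_sum_right)

lemma tensor_adj_add: "tensor_adj b (v + w) = tensor_adj b v + tensor_adj b w"
  by (simp add: tensor_adj_def scaleR_add_right sum.distrib)

lemma tensor_adj_tensor_op:
  "tensor_adj b (tensor_op (transpose K) w) = tensor_adj (K *v b) w"
  for K :: "real ^ 'm::finite ^ 'n::finite"
proof -
  have "tensor_adj b (tensor_op (transpose K) w)
      = (\<Sum>j\<in>UNIV. \<Sum>i\<in>UNIV. (K $ i $ j * b $ j) *\<^sub>R w $ i)"
    by (simp add: tensor_adj_def transpose_def scaleR_sum_right mult.commute)
  also have "\<dots> = (\<Sum>i\<in>UNIV. \<Sum>j\<in>UNIV. (K $ i $ j * b $ j) *\<^sub>R w $ i)"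
    by (rule sum.swap)
  finally show ?thesis
    by (simp add: tensor_adj_def matrix_vector_mult_def scaleR_sum_left)
qed

lemma tendsto_tensor_op:
  fixes f :: "'b \<Rightarrow> 'a::real_normed_vector ^ 'p::finite"
  assumes "(f \<longlongrightarrow> l) F"
  shows "((\<lambda>k. tensor_op K (f k)) \<longlongrightarrow> tensor_op K l) F"
  by (rule vec_tendstoI) (auto intro!: tendsto_intros assms)

lemma closed_tensor_op_vimage:
  fixes S :: "('a::real_normed_vector ^ 'm::finite) set"
  assumes "closed S"
  shows "closed {x :: 'a ^ 'p::finite. tensor_op K x \<in> S}"
proof -
  have "continuous_on UNIV (tensor_op K :: 'a ^ 'p \<Rightarrow> 'a ^ 'm)"
    unfolding continuous_on_def by (auto intro: tendsto_tensor_op tendsto_ident_at)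
  then show ?thesis
    using closed_vimage[OF assms] by (simp add: vimage_def)
qed

section \<open>The Laplacian as a Dirichlet energy\<close>

text \<open>
  Each directed edge contributes once. If no edge occurs in both directions, this is the quadratic
  form of the Laplacian.
\<close>
definition dirichlet :: "('n \<times> 'n) set \<Rightarrow> 'a::real_inner ^ 'n \<Rightarrow> real" where
  "dirichlet G x = (\<Sum>(i, j)\<in>G. (norm (x $ i - x $ j))\<^sup>2)"

lemma sum_out_edges:
  fixes G :: "('n::finite \<times> 'n) set"
  shows "(\<Sum>i\<in>UNIV. \<Sum>h | (i, h) \<in> G. f i h) = (\<Sum>(i, h)\<in>G. f i h)"
proof -
  have "G = Sigma UNIV (\<lambda>i. {h. (i, h) \<in> G})"
    by auto
  then show ?thesis
    by (simp add: sum.Sigma)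
qed

lemma sum_in_edges:
  fixes G :: "('n::finite \<times> 'n) set"
  shows "(\<Sum>i\<in>UNIV. \<Sum>h | (h, i) \<in> G. f i h) = (\<Sum>(h, i)\<in>G. f i h)"
proof -
  have "(\<Sum>i\<in>UNIV. \<Sum>h | (h, i) \<in> G. f i h) = (\<Sum>(i, h)\<in>G\<inverse>. f i h)"
    using sum_out_edges[of f "G\<inverse>"] by simp
  also have "\<dots> = (\<Sum>(h, i)\<in>G. f i h)"
    by (rule sum.reindex_bij_witness[of _ prod.swap prod.swap]) auto
  finally show ?thesis .
qed

lemma sum_deg:
  fixes G :: "('n::finite \<times> 'n) set" and f :: "'n \<Rightarrow> real"
  shows "(\<Sum>i\<in>UNIV. real (deg G i) * f i) = (\<Sum>(i, j)\<in>G. f i + f j)"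
proof -
  have "(\<Sum>i\<in>UNIV. real (deg G i) * f i)
      = (\<Sum>i\<in>UNIV. \<Sum>h | (i, h) \<in> G. f i) + (\<Sum>i\<in>UNIV. \<Sum>h | (h, i) \<in> G. f i)"
    by (simp add: deg_def indeg_def outdeg_def distrib_right sum.distrib)
  also have "\<dots> = (\<Sum>(i, j)\<in>G. f i) + (\<Sum>(i, j)\<in>G. f j)"
    by (simp only: sum_out_edges sum_in_edges)
  also have "\<dots> = (\<Sum>(i, j)\<in>G. f i + f j)"
    by (simp add: split_def sum.distrib)
  finally show ?thesis .
qed

lemma sum_degree_balance: "(\<Sum>i\<in>UNIV. degree_balance G $ i) = 0"
proof -
  have "degree_balance G $ i = (\<Sum>h | (i, h) \<in> G. 1) - (\<Sum>h | (h, i) \<in> G. 1)" for i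
    by (simp add: degree_balance_def indeg_def outdeg_def)
  then show ?thesis
    by (simp add: sum_subtractf sum_out_edges[of "\<lambda>_ _. 1"] sum_in_edges[of "\<lambda>_ _. 1"] del: sum_constant)
qed

text \<open>
  When the edges increase along an order of the nodes, the right-hand side is the quadratic form of
  the triangular matrix that one sweep of the algorithm solves, with the degrees on the diagonal and
  \<open>-2\<close> at the edges.
\<close>
lemma dirichlet_eq:
  fixes x :: "'a::real_inner ^ 'n::finite"
  shows "dirichlet G x = (\<Sum>i\<in>UNIV. inner (x $ i) (real (deg G i) *\<^sub>R x $ i - 2 *\<^sub>R (\<Sum>h | (h, i) \<in> G. x $ h)))"
proof -
  have "dirichlet G x = (\<Sum>(i, j)\<in>G. (norm (x $ i))\<^sup>2 + (norm (x $ j))\<^sup>2) - 2 * (\<Sum>(h, i)\<in>G. inner (x $ i) (x $ h))"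
    by (auto simp: dirichlet_def power2_norm_eq_inner inner_diff inner_commute sum_distrib_left
        simp flip: sum_subtractf intro!: sum.cong)
  also have "\<dots> = (\<Sum>i\<in>UNIV. real (deg G i) * (norm (x $ i))\<^sup>2)
      - 2 * (\<Sum>i\<in>UNIV. \<Sum>h | (h, i) \<in> G. inner (x $ i) (x $ h))"
    by (simp add: sum_deg sum_in_edges)
  also have "\<dots> = (\<Sum>i\<in>UNIV. inner (x $ i) (real (deg G i) *\<^sub>R x $ i - 2 *\<^sub>R (\<Sum>h | (h, i) \<in> G. x $ h)))"
    by (simp add: inner_diff_right inner_sum_right sum_subtractf sum_distrib_left power2_norm_eq_inner)
  finally show ?thesis .
qed

text \<open>
  Asymmetry of \<open>G\<close> keeps the two sums over neighbours disjoint: a pair joined in both directions would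
  be counted twice on the right but only once in \<open>Lap G\<close>.
\<close>
lemma tensor_op_Lap:
  fixes w :: "'a::real_vector ^ 'n::finite"
  assumes "asym G"
  shows "tensor_op (Lap G) w $ i
    = real (deg G i) *\<^sub>R (w $ i) - (\<Sum>h | (i, h) \<in> G. w $ h) - (\<Sum>h | (h, i) \<in> G. w $ h)"
proof -
  have irr: "(i, i) \<notin> G" and as: "(i, h) \<in> G \<Longrightarrow> (h, i) \<notin> G" for h
    using assms by (auto dest: asymD)
  have "Lap G $ i $ j *\<^sub>R w $ j = (if j = i then real (deg G i) *\<^sub>R w $ j else 0)
      - (if (i, j) \<in> G then w $ j else 0) - (if (j, i) \<in> G then w $ j else 0)" for j
    using irr as[of j] by (auto simp: Lap_def)
  then show ?thesis
    by (simp add: sum_subtractf sum.If_cases)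
qed

lemma inner_Lap:
  fixes x :: "'a::real_inner ^ 'n::finite"
  assumes "asym G"
  shows "inner x (tensor_op (Lap G) x) = dirichlet G x"
proof -
  have "inner x (tensor_op (Lap G) x) = (\<Sum>i\<in>UNIV. real (deg G i) * (norm (x $ i))\<^sup>2)
      - (\<Sum>i\<in>UNIV. \<Sum>h | (i, h) \<in> G. inner (x $ i) (x $ h))
      - (\<Sum>i\<in>UNIV. \<Sum>h | (h, i) \<in> G. inner (x $ i) (x $ h))"
    unfolding inner_vec_def tensor_op_Lap[OF assms]
    by (simp add: inner_diff_right inner_sum_right sum_subtractf power2_norm_eq_inner)
  also have "\<dots> = (\<Sum>i\<in>UNIV. real (deg G i) * (norm (x $ i))\<^sup>2)
      - 2 * (\<Sum>i\<in>UNIV. \<Sum>h | (h, i) \<in> G. inner (x $ i) (x $ h))"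
    by (simp add: sum_out_edges sum_in_edges inner_commute)
  also have "\<dots> = dirichlet G x"
    by (simp add: dirichlet_eq inner_diff_right inner_sum_right sum_subtractf sum_distrib_left power2_norm_eq_inner)
  finally show ?thesis .
qed

lemma dirichlet_mono:
  fixes G :: "('n::finite \<times> 'n) set"
  assumes "G' \<subseteq> G"
  shows "dirichlet G' x \<le> dirichlet G x"
  unfolding dirichlet_def by (rule sum_mono2) (use assms in auto)

lemma dirichlet_eq_0_imp_constant:
  fixes G :: "('n::finite \<times> 'n) set" and x :: "'a::real_inner ^ 'n"
  assumes G: "connected_graph G" and 0: "dirichlet G x = 0"
  shows "x $ i = x $ j"
proof -
  have "\<forall>e\<in>G. (case e of (i, j) \<Rightarrow> (norm (x $ i - x $ j))\<^sup>2) = 0"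
    using 0 unfolding dirichlet_def by (subst (asm) sum_nonneg_eq_0_iff) auto
  then have edge: "x $ a = x $ b" if "(a, b) \<in> G \<union> G\<inverse>" for a b
    using that by fastforce
  have "(i, j) \<in> (G \<union> G\<inverse>)\<^sup>*"
    using G by (simp add: connected_graph_def)
  then show ?thesis
    by (induction rule: rtrancl_induct) (use edge in auto)
qed

lemma deg_pos:
  fixes G :: "('n::finite \<times> 'n) set"
  assumes card: "CARD('n) \<ge> 2" and con: "connected_graph G"
  shows "0 < deg G i"
proof -
  have "\<exists>j. j \<noteq> i"
  proof (rule ccontr)
    assume "\<not> (\<exists>j. j \<noteq> i)"
    then have "(UNIV :: 'n set) = {i}"
      by auto
    then have "CARD('n) = card {i}"
      by (rule arg_cong)
    with card show False
      by simp
  qed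
  then obtain j where "j \<noteq> i" ..
  moreover have "(i, j) \<in> (G \<union> G\<inverse>)\<^sup>*"
    using con by (simp add: connected_graph_def)
  ultimately obtain h where "(i, h) \<in> G \<union> G\<inverse>"
    by (metis converse_rtranclE)
  then have "{h. (h, i) \<in> G} \<noteq> {} \<or> {h. (i, h) \<in> G} \<noteq> {}"
    by auto
  then show ?thesis
    by (auto simp: deg_def indeg_def outdeg_def card_gt_0_iff)
qed

text \<open>The least node has no incoming edge, and by connectedness it has an outgoing one.\<close>
lemma degree_balance_nonzero:
  fixes G :: "('n::{finite,linorder} \<times> 'n) set"
  assumes G: "algorithmic_graph G"
  shows "degree_balance G \<noteq> 0"
proof -
  let ?m = "Min (UNIV :: 'n set)"
  have "{j. (j, ?m) \<in> G} = {}"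
    using G by (auto simp: algorithmic_graph_def not_less)
      (meson Min_le UNIV_I finite_class.finite_UNIV leD)
  then have "indeg G ?m = 0"
    by (simp add: indeg_def)
  moreover have "0 < deg G ?m"
    using G by (intro deg_pos) (auto simp: algorithmic_graph_def)
  ultimately have "degree_balance G $ ?m \<noteq> 0"
    by (simp add: degree_balance_def deg_def)
  then show ?thesis
    by auto
qed

section \<open>Factors of the Laplacian and their Moore--Penrose inverse\<close>

lemma norm_transpose_factor:
  fixes Z :: "real ^ 'm::finite ^ 'n::finite" and x :: "'a::real_inner ^ 'n"
  assumes "asym G" "Lap G = Z ** transpose Z"
  shows "(norm (tensor_op (transpose Z) x))\<^sup>2 = dirichlet G x"
  using inner_Lap[OF assms(1), of x] inner_tensor_op[of "transpose Z" x "tensor_op (transpose Z) x"]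
  by (simp add: assms(2) tensor_op_matrix_mult power2_norm_eq_inner)

text \<open>By the norm identity, \<open>Z\<^sup>* x = 0\<close> means that \<open>x\<close> has no Dirichlet energy.\<close>
lemma transpose_factor_kernel:
  fixes Z :: "real ^ 'm::finite ^ 'n::finite" and x :: "'a::real_inner ^ 'n"
  assumes G: "asym G" "connected_graph G" and Z: "Lap G = Z ** transpose Z"
  shows "tensor_op (transpose Z) x = 0 \<longleftrightarrow> (\<exists>u. x = (\<chi> i. u))"
proof
  assume "tensor_op (transpose Z) x = 0"
  then have "dirichlet G x = 0"
    using norm_transpose_factor[OF G(1) Z, of x] by simp
  then show "\<exists>u. x = (\<chi> i. u)"
    using dirichlet_eq_0_imp_constant[OF G(2)] by (metis vec_lambda_unique)
next
  assume "\<exists>u. x = (\<chi> i. u)"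
  then show "tensor_op (transpose Z) x = 0"
    using norm_transpose_factor[OF G(1) Z, of x] by (auto simp: dirichlet_def)
qed

lemma matrix_vector_mult_eq_tensor_op: "K *v x = tensor_op K x"
  by (simp add: vec_eq_iff matrix_vector_mult_def)

text \<open>
  The kernel of \<open>Z\<^sup>*\<close> consists of the constant vectors, so \<open>Z\<close> has rank \<open>n - 1\<close>, which is its number of
  columns.
\<close>
lemma inj_laplacian_factor:
  fixes Z :: "real ^ 'm::finite ^ 'n::finite"
  assumes G: "asym G" "connected_graph G" and Z: "Lap G = Z ** transpose Z"
    and card: "CARD('m) = CARD('n) - 1"
  shows "inj ((*v) Z)"
proof -
  let ?R = "range ((*v) Z)"
  have "subspace ?R"
    by (intro linear_subspace_image) auto
  then have "dim {y \<in> UNIV. \<forall>x\<in>?R. orthogonal x y} + dim ?R = dim (UNIV :: (real ^ 'n) set)"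
    by (intro dim_subspace_orthogonal_to_vectors) auto
  moreover have "{y \<in> UNIV. \<forall>x\<in>?R. orthogonal x y} \<subseteq> span {1}"
  proof
    fix y assume y: "y \<in> {y \<in> UNIV. \<forall>x\<in>?R. orthogonal x y}"
    have "inner (Z *v (transpose Z *v y)) y = 0"
      using y by (auto simp: orthogonal_def)
    then have "tensor_op (transpose Z) y = 0"
      using inner_tensor_op[of Z "tensor_op (transpose Z) y" y]
      by (simp add: matrix_vector_mult_eq_tensor_op)
    then obtain c where "y = (\<chi> i. c)"
      using transpose_factor_kernel[OF G Z] by blast
    then have "y = c *\<^sub>R 1"
      by (simp add: vec_eq_iff)
    then show "y \<in> span {1}"
      by (simp add: span_base span_scale)
  qed
  then have "dim {y \<in> UNIV. \<forall>x\<in>?R. orthogonal x y} \<le> card {1 :: real ^ 'n}"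
    by (intro dim_le_card) auto
  ultimately have "CARD('n) - 1 \<le> rank Z"
    by (simp add: rank_dim_range)
  then have "rank Z = CARD('m)"
    using rank_bound[of Z] card by simp
  then show ?thesis
    by (simp add: full_rank_injective)
qed

text \<open>
  For an injective \<open>Z\<close> the matrix \<open>Y = (Z\<^sup>* Z)\<^sup>-\<^sup>1 Z\<^sup>*\<close> satisfies the Penrose equations. Conversely,
  transposing \<open>Z X Z = Z\<close> with \<open>Z X\<close> symmetric gives \<open>Z\<^sup>* Z X = Z\<^sup>*\<close>, hence \<open>X = Y\<close>.
\<close>
lemma moore_penrose_injective:
  fixes Z :: "real ^ 'm::finite ^ 'n::finite"
  assumes inj: "inj ((*v) Z)"
  shows "moore_penrose Z ** Z = mat 1"
    and "transpose (Z ** moore_penrose Z) = Z ** moore_penrose Z"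
proof -
  let ?P = "\<lambda>X. Z ** X ** Z = Z \<and> X ** Z ** X = X \<and>
      transpose (Z ** X) = Z ** X \<and> transpose (X ** Z) = X ** Z"
  let ?K = "transpose Z ** Z"
  have "?K *v x = 0 \<Longrightarrow> x = 0" for x
  proof -
    assume "?K *v x = 0"
    then have "inner (Z *v x) (Z *v x) = 0"
      by (simp add: matrix_vector_mult_eq_tensor_op inner_tensor_op tensor_op_matrix_mult)
    then show "x = 0"
      using inj by (metis inj_eq inner_eq_zero_iff matrix_vector_mult_0_right)
  qed
  then obtain B where BK: "B ** ?K = mat 1"
    using matrix_left_invertible_ker by blast
  then have KB: "?K ** B = mat 1"
    by (simp add: matrix_left_right_inverse)
  have tK: "transpose ?K = ?K"
    by (simp add: matrix_transpose_mul)
  have "transpose B ** ?K = mat 1"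
    using arg_cong[OF KB, of transpose] by (simp add: matrix_transpose_mul[of ?K B] tK transpose_mat)
  then have "transpose B ** (?K ** B) = B"
    by (simp add: matrix_mul_assoc)
  then have tB: "transpose B = B"
    by (simp only: KB matrix_mul_rid)
  let ?Y = "B ** transpose Z"
  have YZ: "?Y ** Z = mat 1"
    using BK by (simp add: matrix_mul_assoc)
  have Y: "?P ?Y"
    using YZ by (simp add: matrix_mul_assoc[symmetric] matrix_transpose_mul tB transpose_mat)
  have uniq: "X = ?Y" if X: "?P X" for X
  proof -
    have "transpose Z ** (Z ** X) = transpose (Z ** X ** Z)"
      using X by (metis matrix_transpose_mul transpose_transpose)
    then have "?K ** X = transpose Z"
      using X by (simp add: matrix_mul_assoc)
    then have "B ** ?K ** X = ?Y"
      by (simp only: flip: matrix_mul_assoc)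
    then show ?thesis
      by (simp only: BK matrix_mul_lid)
  qed
  have "moore_penrose Z = ?Y"
    unfolding moore_penrose_def by (rule the_equality[of ?P, OF Y uniq])
  then show "moore_penrose Z ** Z = mat 1"
    and "transpose (Z ** moore_penrose Z) = Z ** moore_penrose Z"
    using YZ Y by simp_all
qed

text \<open>
  The range of \<open>Z\<close> is the orthogonal complement of the kernel \<open>span {1}\<close> of \<open>Z\<^sup>*\<close>, and \<open>Z Z\<^sup>\<dagger>\<close> is the
  projection onto it. For vectors with entries in a Hilbert space this does not follow from dimensions;
  it does from the matrix \<open>M = Id - Z Z\<^sup>\<dagger>\<close>: by \<open>Z\<^sup>* M = 0\<close> its columns are
  constant, by symmetry so are its rows, and such a matrix only sees the sum of the entries.
\<close>
lemma factor_moore_penrose_mean_zero: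
  fixes Z :: "real ^ 'm::finite ^ 'n::finite" and y :: "'a::real_inner ^ 'n"
  assumes G: "asym G" "connected_graph G" and Z: "Lap G = Z ** transpose Z"
    and card: "CARD('m) = CARD('n) - 1" and y: "(\<Sum>i\<in>UNIV. y $ i) = 0"
  shows "tensor_op Z (tensor_op (moore_penrose Z) y) = y"
proof -
  define X where "X = moore_penrose Z"
  define M where "M = mat 1 - Z ** X"
  have XZ: "X ** Z = mat 1" and sym: "transpose (Z ** X) = Z ** X"
    using moore_penrose_injective[OF inj_laplacian_factor[OF G Z card]] by (simp_all add: X_def)
  have tM: "transpose M = M"
  proof -
    have "transpose M = transpose (mat 1) - transpose (Z ** X)"
      by (simp add: M_def vec_eq_iff transpose_def)
    then show ?thesis
      by (simp only: M_def sym transpose_mat)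
  qed
  have "M ** Z = mat 1 ** Z - Z ** X ** Z"
    by (simp add: vec_eq_iff M_def matrix_matrix_mult_def left_diff_distrib sum_subtractf)
  then have MZ: "M ** Z = 0"
    using XZ by (simp flip: matrix_mul_assoc)
  have "transpose Z ** M = transpose (M ** Z)"
    by (simp add: matrix_transpose_mul tM)
  then have ZM: "transpose Z ** M = 0"
    by (simp add: MZ vec_eq_iff transpose_def)
  have col: "M $ i $ j = M $ i' $ j" for i i' j
  proof -
    have "tensor_op (transpose Z) (column j M) = column j (transpose Z ** M)"
      by (simp add: vec_eq_iff column_def matrix_matrix_mult_def)
    also have "\<dots> = 0"
      by (simp add: ZM vec_eq_iff column_def)
    finally obtain u where "column j M = (\<chi> i. u)"
      using transpose_factor_kernel[OF G Z] by blast
    then show ?thesis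
      by (simp add: column_def vec_eq_iff)
  qed
  have row: "M $ i $ j = M $ i $ i" for i j
  proof -
    have "M $ i $ j = transpose M $ j $ i"
      by (simp add: transpose_def)
    also have "\<dots> = M $ i $ i"
      unfolding tM by (rule col)
    finally show ?thesis .
  qed
  have "tensor_op M y $ i = M $ i $ i *\<^sub>R (\<Sum>j\<in>UNIV. y $ j)" for i
    unfolding tensor_op_nth scaleR_sum_right by (intro sum.cong refl arg_cong2[where f = scaleR] row)
  then have "tensor_op M y = 0"
    using y by (simp add: vec_eq_iff)
  moreover have "tensor_op M y = tensor_op (mat 1) y - tensor_op (Z ** X) y"
    by (simp add: vec_eq_iff M_def scaleR_diff_left sum_subtractf)
  ultimately show ?thesis
    by (simp add: X_def tensor_op_matrix_mult tensor_op_mat_1)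
qed

section \<open>The sweep through the nodes\<close>

text \<open>
  The normal cone of a subspace is invariant under scaling, so its scaled resolvent is the orthogonal
  projection for every scaling.
\<close>
lemma resolvent_normal_coneD:
  assumes S: "subspace S" and res: "resolvent (scale_op c (normal_cone S)) y = {x}"
  shows "x \<in> S" "y - x \<in> S\<^sup>\<bottom>"
proof -
  have "x \<in> resolvent (scale_op c (normal_cone S)) y"
    using res by simp
  then obtain a where a: "a \<in> normal_cone S x" "y = x + c *\<^sub>R a"
    by (auto simp: resolvent_def scale_op_def)
  then show "x \<in> S"
    by (auto simp: normal_cone_def split: if_splits)
  then have "a \<in> S\<^sup>\<bottom>"
    using a by (simp add: normal_cone_def)
  then show "y - x \<in> S\<^sup>\<bottom>"
    using a by (simp add: subspace_scale subspace_orthogonal_comp)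
qed

lemma wf_less_finite: "wf {(h, i :: 'n::{finite,linorder}). h < i}"
proof (rule wf_subset[OF wf_measure[of "\<lambda>i :: 'n. card {h. h < i}"]])
  show "{(h, i :: 'n). h < i} \<subseteq> Wellfounded.measure (\<lambda>i. card {h. h < i})"
    by (auto intro!: psubset_card_mono)
qed

locale subspace_sweep =
  fixes U :: "'n::{finite,linorder} \<Rightarrow> 'a::{real_inner,complete_space} set"
    and G :: "('n \<times> 'n) set"
  assumes subspace_U: "subspace (U i)" and closed_U: "closed (U i)"
    and algorithmic: "algorithmic_graph G"
begin

lemma edge_less: "(i, j) \<in> G \<Longrightarrow> i < j"
  using algorithmic by (simp add: algorithmic_graph_def)

lemma degree_pos: "0 < deg G i"
  using algorithmic by (intro deg_pos) (auto simp: algorithmic_graph_def)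

text \<open>
  The update of the nodes after multiplication by \<open>d\<^sub>i\<close>: writing \<open>D - 2N\<close> for the lower triangular
  matrix with the degrees on the diagonal and \<open>-2\<close> at the edges of \<open>G\<close>, \<open>x \<in> \<U>\<close> solves
  \<open>b - (D - 2N) x \<in> \<U>\<^sup>\<bottom>\<close>.
\<close>
definition solution :: "('a, 'n) vec \<Rightarrow> ('a, 'n) vec \<Rightarrow> bool" where
  "solution b x \<longleftrightarrow> (\<forall>i. x $ i \<in> U i \<and>
     b $ i + 2 *\<^sub>R (\<Sum>h | (h, i) \<in> G. x $ h) - real (deg G i) *\<^sub>R x $ i \<in> (U i)\<^sup>\<bottom>)"

text \<open>Forward substitution along the order of the nodes.\<close>
lemma ex_solution: "\<exists>x. solution b x"
proof -
  let ?P = "\<lambda>f i r. r \<in> U i \<and>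
     b $ i + 2 *\<^sub>R (\<Sum>h | (h, i) \<in> G. f h) - real (deg G i) *\<^sub>R r \<in> (U i)\<^sup>\<bottom>"
  have "\<exists>f. \<forall>i. ?P f i (f i)"
  proof (rule dependent_wf_choice[OF wf_less_finite])
    fix f g :: "'n \<Rightarrow> 'a" and i r
    assume "\<And>h. (h, i) \<in> {(h, i). h < i} \<Longrightarrow> f h = g h"
    then have "(\<Sum>h | (h, i) \<in> G. f h) = (\<Sum>h | (h, i) \<in> G. g h)"
      by (intro sum.cong refl) (auto dest: edge_less)
    then show "?P f i r = ?P g i r"
      by simp
  next
    fix i and f :: "'n \<Rightarrow> 'a"
    let ?c = "b $ i + 2 *\<^sub>R (\<Sum>h | (h, i) \<in> G. f h)"
    obtain p where p: "p \<in> U i" "?c - p \<in> (U i)\<^sup>\<bottom>"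
      using orthogonal_decomposition[OF subspace_U closed_U] by blast
    have "?P f i ((1 / real (deg G i)) *\<^sub>R p)"
      using p degree_pos[of i] by (simp add: subspace_scale[OF subspace_U])
    then show "\<exists>r. ?P f i r" ..
  qed
  then obtain f where "\<forall>i. ?P f i (f i)" ..
  then have "solution b (\<chi> i. f i)"
    by (simp add: solution_def)
  then show ?thesis ..
qed

lemma solution_add:
  assumes "solution b x" "solution b' x'"
  shows "solution (b + b') (x + x')"
  unfolding solution_def
proof (intro allI conjI)
  fix i
  show "(x + x') $ i \<in> U i"
    using assms by (simp add: solution_def subspace_add[OF subspace_U])
  have "(b $ i + 2 *\<^sub>R (\<Sum>h | (h, i) \<in> G. x $ h) - real (deg G i) *\<^sub>R x $ i)
      + (b' $ i + 2 *\<^sub>R (\<Sum>h | (h, i) \<in> G. x' $ h) - real (deg G i) *\<^sub>R x' $ i) \<in> (U i)\<^sup>\<bottom>"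
    using assms by (intro subspace_add subspace_orthogonal_comp) (auto simp: solution_def)
  then show "(b + b') $ i + 2 *\<^sub>R (\<Sum>h | (h, i) \<in> G. (x + x') $ h)
      - real (deg G i) *\<^sub>R (x + x') $ i \<in> (U i)\<^sup>\<bottom>"
    by (simp add: sum.distrib scaleR_add_right algebra_simps)
qed

lemma solution_scaleR:
  assumes "solution b x"
  shows "solution (c *\<^sub>R b) (c *\<^sub>R x)"
  unfolding solution_def
proof (intro allI conjI)
  fix i
  show "(c *\<^sub>R x) $ i \<in> U i"
    using assms by (simp add: solution_def subspace_scale[OF subspace_U])
  have "c *\<^sub>R (b $ i + 2 *\<^sub>R (\<Sum>h | (h, i) \<in> G. x $ h) - real (deg G i) *\<^sub>R x $ i) \<in> (U i)\<^sup>\<bottom>"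
    using assms by (intro subspace_scale subspace_orthogonal_comp) (auto simp: solution_def)
  then show "(c *\<^sub>R b) $ i + 2 *\<^sub>R (\<Sum>h | (h, i) \<in> G. (c *\<^sub>R x) $ h)
      - real (deg G i) *\<^sub>R (c *\<^sub>R x) $ i \<in> (U i)\<^sup>\<bottom>"
    by (simp add: scaleR_diff_right scaleR_add_right scaleR_sum_right mult.commute)
qed

lemma solution_diff:
  assumes "solution b x" "solution b' x'"
  shows "solution (b - b') (x - x')"
  using solution_add[OF assms(1) solution_scaleR[OF assms(2), of "- 1"]] by simp

text \<open>
  Forward substitution again: at node \<open>i\<close> the solution is a projection divided by \<open>d\<^sub>i\<close>, so it is
  bounded by \<open>b\<^sub>i\<close> and by the values at smaller nodes. Applied to a constant sequence with \<open>b = 0\<close>, this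
  also yields uniqueness.
\<close>
lemma solutions_tendsto_0:
  assumes sol: "\<And>k. solution (b k) (y k)" and b: "b \<longlonglongrightarrow> 0"
  shows "y \<longlonglongrightarrow> 0"
proof (rule vec_tendstoI)
  fix i
  show "(\<lambda>k. y k $ i) \<longlonglongrightarrow> 0 $ i"
  proof (induction i rule: wf_induct_rule[OF wf_less_finite])
    case (1 i)
    let ?d = "real (deg G i)"
    define c where "c k = b k $ i + 2 *\<^sub>R (\<Sum>h | (h, i) \<in> G. y k $ h)" for k
    have "(\<lambda>k. y k $ h) \<longlonglongrightarrow> 0" if "(h, i) \<in> G" for h
      using 1[of h] edge_less[OF that] by simp
    then have "c \<longlonglongrightarrow> 0 $ i + 2 *\<^sub>R (\<Sum>h | (h, i) \<in> G. 0)"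
      unfolding c_def using b by (intro tendsto_intros) auto
    then have "(\<lambda>k. norm (c k) / ?d) \<longlonglongrightarrow> norm (0 :: 'a) / ?d"
      using degree_pos[of i] by (intro tendsto_intros) auto
    then have lim: "(\<lambda>k. norm (c k) / ?d) \<longlonglongrightarrow> 0"
      by simp
    have "norm (y k $ i) \<le> norm (c k) / ?d" for k
    proof -
      have "y k $ i \<in> U i" "c k - ?d *\<^sub>R y k $ i \<in> (U i)\<^sup>\<bottom>"
        using sol[of k] by (auto simp: solution_def c_def)
      then have "inner (y k $ i) (c k - ?d *\<^sub>R y k $ i) = 0"
        by (intro orthogonal_compD)
      then have "?d * norm (y k $ i) * norm (y k $ i) = inner (y k $ i) (c k)"
        by (simp add: inner_diff_right power2_norm_eq_inner[symmetric] power2_eq_square)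
      also have "\<dots> \<le> norm (c k) * norm (y k $ i)"
        using norm_cauchy_schwarz[of "y k $ i" "c k"] by (simp add: mult.commute)
      finally have "?d * norm (y k $ i) \<le> norm (c k)"
        by (cases "y k $ i = 0") auto
      then show ?thesis
        using degree_pos[of i] by (simp add: field_simps)
    qed
    then have "(\<lambda>k. y k $ i) \<longlonglongrightarrow> 0"
      by (intro Lim_null_comparison[OF always_eventually lim]) blast
    then show ?case
      by simp
  qed
qed

lemma solution_unique:
  assumes "solution b x" "solution b x'"
  shows "x = x'"
proof -
  have "(\<lambda>k::nat. x - x') \<longlonglongrightarrow> 0"
    using solution_diff[OF assms] by (simp add: solutions_tendsto_0[of "\<lambda>_. 0"])
  then show ?thesis
    by (simp add: LIMSEQ_const_iff)
qed

definition sweep :: "('a, 'n) vec \<Rightarrow> ('a, 'n) vec" where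
  "sweep b = (THE x. solution b x)"

lemma sweep_eqI: "solution b x \<Longrightarrow> sweep b = x"
  unfolding sweep_def using solution_unique by (intro the_equality) auto

lemma solution_sweep: "solution b (sweep b)"
  using ex_solution[of b] sweep_eqI by metis

lemma linear_sweep: "linear sweep"
  by (rule linearI) (auto intro!: sweep_eqI solution_add solution_scaleR solution_sweep)

lemma sweep_tendsto:
  assumes "b \<longlonglongrightarrow> l"
  shows "(\<lambda>k. sweep (b k)) \<longlonglongrightarrow> sweep l"
proof -
  have "(\<lambda>k. sweep (b k) - sweep l) \<longlonglongrightarrow> 0"
    by (rule solutions_tendsto_0[OF solution_diff[OF solution_sweep solution_sweep]])
      (use assms in \<open>simp add: LIM_zero\<close>)
  then show ?thesis
    by (simp add: LIM_zero_iff)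
qed

text \<open>
  Membership of \<open>x\<close> in \<open>\<U>\<close> removes the normal components from \<open>\<langle>x, b\<rangle>\<close>, which leaves the quadratic form of
  \<open>D - 2N\<close>.
\<close>
lemma inner_sweep: "inner (sweep b) b = dirichlet G (sweep b)"
proof -
  have "inner (sweep b $ i) (b $ i) = inner (sweep b $ i)
      (real (deg G i) *\<^sub>R sweep b $ i - 2 *\<^sub>R (\<Sum>h | (h, i) \<in> G. sweep b $ h))" for i
  proof -
    have "inner (sweep b $ i)
        (b $ i + 2 *\<^sub>R (\<Sum>h | (h, i) \<in> G. sweep b $ h) - real (deg G i) *\<^sub>R sweep b $ i) = 0"
      using solution_sweep[of b] by (intro orthogonal_compD[of _ "U i"]) (auto simp: solution_def)
    then show ?thesis
      by (simp add: inner_diff_right inner_add_right)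
  qed
  then show ?thesis
    by (simp add: inner_vec_def dirichlet_eq)
qed

text \<open>The row sums of \<open>D - 2N\<close> are \<open>d\<^sub>i - 2 d\<^sub>i\<^sup>i\<^sup>n\<close>, the degree balance; this is how \<open>\<delta>\<close> enters.\<close>
lemma sweep_eq_constant_iff:
  "sweep b = (\<chi> i. u) \<longleftrightarrow>
     u \<in> (\<Inter>i. U i) \<and> b - (\<chi> i. (degree_balance G $ i) *\<^sub>R u) \<in> product_set (\<lambda>i. (U i)\<^sup>\<bottom>)"
proof -
  have eq: "b $ i + 2 *\<^sub>R (\<Sum>h | (h, i) \<in> G. u) - real (deg G i) *\<^sub>R u
      = b $ i - (degree_balance G $ i) *\<^sub>R u" for i
  proof -
    have "2 *\<^sub>R (\<Sum>h | (h, i) \<in> G. u) - real (deg G i) *\<^sub>R u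
        = (2 * real (indeg G i) - real (deg G i)) *\<^sub>R u"
      by (simp add: sum_constant_scaleR indeg_def scaleR_diff_left)
    also have "\<dots> = - ((degree_balance G $ i) *\<^sub>R u)"
      by (simp add: degree_balance_def deg_def flip: scaleR_minus_left)
    finally show ?thesis
      by (simp add: add_diff_eq[symmetric])
  qed
  then have "solution b (\<chi> i. u) \<longleftrightarrow>
     u \<in> (\<Inter>i. U i) \<and> b - (\<chi> i. (degree_balance G $ i) *\<^sub>R u) \<in> product_set (\<lambda>i. (U i)\<^sup>\<bottom>)"
    unfolding solution_def vec_lambda_beta eq by (auto simp: product_set_def)
  then show ?thesis
    using sweep_eqI solution_sweep by metis
qed

end

section \<open>The reduced iteration and its fixed points\<close>

locale graph_splitting = subspace_sweep U G
  for U :: "'n::{finite,linorder} \<Rightarrow> 'a::{real_inner,complete_space} set" and G +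
  fixes G' :: "('n \<times> 'n) set" and Z :: "((real, 'm::finite) vec, 'n) vec" and \<theta> :: real
  assumes subgraph: "G' \<subseteq> G" and connected: "connected_graph G'"
    and card_m: "CARD('m) = CARD('n) - 1" and factor: "Lap G' = Z ** transpose Z"
    and \<theta>: "0 < \<theta>" "\<theta> < 2"
begin

abbreviation "Zd \<equiv> moore_penrose Z"
abbreviation "\<delta> \<equiv> degree_balance G"
definition "\<alpha> = Zd *v \<delta>"

text \<open>One step of the algorithm, seen on the combination \<open>Z\<^sup>* w + v\<close> of its two variables.\<close>
definition T :: "'a ^ 'm \<Rightarrow> 'a ^ 'm" where
  "T s = s - \<theta> *\<^sub>R tensor_op (transpose Z) (sweep (tensor_op Z s))"

lemma asym_G': "asym G'"
  using subgraph edge_less by (intro asymI) (meson less_asym subsetD)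

lemmas norm_Zt = norm_transpose_factor[OF asym_G' factor]
lemmas ker_Zt = transpose_factor_kernel[OF asym_G' connected factor]
lemmas Z_Zd = factor_moore_penrose_mean_zero[OF asym_G' connected factor card_m]
lemmas moore_penrose_Z = moore_penrose_injective[OF inj_laplacian_factor[OF asym_G' connected factor card_m]]

lemma Zd_Z: "tensor_op Zd (tensor_op Z s) = s"
  using moore_penrose_Z(1) by (simp add: tensor_op_mat_1 flip: tensor_op_matrix_mult)

lemma sum_Z: "(\<Sum>i\<in>UNIV. tensor_op Z s $ i) = 0"
  for s :: "'b::real_inner ^ 'm"
proof -
  let ?t = "\<Sum>i\<in>UNIV. tensor_op Z s $ i"
  have "inner ?t ?t = inner (tensor_op Z s) (\<chi> i. ?t)"
    by (simp add: inner_vec_def inner_sum_left)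
  also have "\<dots> = inner s (tensor_op (transpose Z) (\<chi> i. ?t))"
    by (rule inner_tensor_op)
  also have "tensor_op (transpose Z) (\<chi> i. ?t) = 0"
    using ker_Zt[of "\<chi> i. ?t"] by blast
  finally show ?thesis
    by simp
qed

lemma Z_\<alpha>: "Z *v \<alpha> = \<delta>"
  unfolding \<alpha>_def matrix_vector_mult_eq_tensor_op by (rule Z_Zd) (rule sum_degree_balance)

lemma \<alpha>_nonzero: "\<alpha> \<noteq> 0"
  using Z_\<alpha> degree_balance_nonzero[OF algorithmic] by auto

lemma linear_T: "linear T"
proof -
  have "linear (\<lambda>s. tensor_op (transpose Z) (sweep (tensor_op Z s)))"
    using linear_compose[OF linear_compose[OF linear_tensor_op linear_sweep] linear_tensor_op]
    by (simp add: o_def)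
  then show ?thesis
    unfolding T_def by (intro linear_compose_sub linear_compose_scale_right linear_ident)
qed

text \<open>
  Let \<open>x\<close> be the sweep from \<open>Z s\<close> and \<open>g = Z\<^sup>* x\<close>. Then \<open>\<langle>s, g\<rangle> = \<langle>x, Z s\<rangle>\<close> is the Dirichlet energy of \<open>x\<close> in
  \<open>G\<close>, while \<open>\<parallel>g\<parallel>\<^sup>2\<close> is its energy in the subgraph \<open>G'\<close>. Hence \<open>\<parallel>g\<parallel>\<^sup>2 \<le> \<langle>s, g\<rangle>\<close>, which is firm
  nonexpansiveness of \<open>s \<mapsto> s - g\<close>; relaxation by \<open>\<theta>\<close> gives the stated constant.
\<close>
lemma averaged_T: "averaged ((2 - \<theta>) / \<theta>) T"
  unfolding averaged_def
proof
  fix s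
  let ?x = "sweep (tensor_op Z s)"
  let ?g = "tensor_op (transpose Z) ?x"
  have "(norm ?g)\<^sup>2 \<le> inner ?x (tensor_op Z s)"
    unfolding norm_Zt inner_sweep by (rule dirichlet_mono[OF subgraph])
  also have "\<dots> = inner s ?g"
    using inner_tensor_op[of Z s ?x] by (simp add: inner_commute)
  finally have g: "(norm ?g)\<^sup>2 \<le> inner s ?g" .
  have "(2 - \<theta>) / \<theta> * (norm (s - T s))\<^sup>2 = \<theta> * (2 - \<theta>) * (norm ?g)\<^sup>2"
    using \<theta> by (simp add: T_def power_mult_distrib power2_eq_square)
  also have "\<dots> = 2 * \<theta> * (norm ?g)\<^sup>2 - \<theta>\<^sup>2 * (norm ?g)\<^sup>2"
    by (simp add: power2_eq_square algebra_simps)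
  also have "\<dots> \<le> 2 * \<theta> * inner s ?g - \<theta>\<^sup>2 * (norm ?g)\<^sup>2"
    using g \<theta> by simp
  also have "\<dots> = (norm s)\<^sup>2 - (norm (T s))\<^sup>2"
    unfolding T_def power2_norm_eq_inner power2_eq_square[of \<theta>]
    by (simp add: inner_diff_left inner_diff_right inner_commute)
  finally show "(2 - \<theta>) / \<theta> * (norm (s - T s))\<^sup>2 \<le> (norm s)\<^sup>2 - (norm (T s))\<^sup>2" .
qed

lemma T_fixed_iff: "T s = s \<longleftrightarrow> (\<exists>u. sweep (tensor_op Z s) = (\<chi> i. u))"
  using \<theta> ker_Zt by (simp add: T_def)

definition "E = tensor_op Zd ` ((product_set U)\<^sup>\<bottom> \<inter> diagonal\<^sup>\<bottom>)"

text \<open>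
  \<open>Z\<close> and \<open>Z\<^sup>\<dagger>\<close> are mutually inverse between \<open>\<H>\<^sup>n\<^sup>-\<^sup>1\<close> and \<open>\<Delta>\<^sup>\<bottom>\<close>, so \<open>E\<close> is also a preimage under \<open>Z\<close>;
  in this form it is visibly closed.
\<close>
lemma E_iff: "e \<in> E \<longleftrightarrow> tensor_op Z e \<in> (product_set U)\<^sup>\<bottom>"
proof
  assume "e \<in> E"
  then show "tensor_op Z e \<in> (product_set U)\<^sup>\<bottom>"
    by (auto simp: E_def orthogonal_comp_diagonal Z_Zd simp del: tensor_op_nth)
next
  assume "tensor_op Z e \<in> (product_set U)\<^sup>\<bottom>"
  moreover have "tensor_op Z e \<in> diagonal\<^sup>\<bottom>"
    using sum_Z[of e] by (simp add: orthogonal_comp_diagonal)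
  ultimately show "e \<in> E"
    unfolding E_def using Zd_Z[of e, symmetric] by blast
qed

lemma subspace_E: "subspace E" and closed_E: "closed E"
proof -
  have E: "E = {e. tensor_op Z e \<in> (product_set U)\<^sup>\<bottom>}"
    using E_iff by auto
  show "subspace E"
    unfolding E using linear_subspace_vimage[OF linear_tensor_op subspace_orthogonal_comp]
    by (simp add: vimage_def)
  show "closed E"
    unfolding E by (intro closed_tensor_op_vimage closed_orthogonal_comp)
qed

text \<open>
  Moving \<open>Z\<^sup>\<dagger>\<close> to the other side of the inner product turns \<open>\<alpha>\<^sub>\<otimes> u\<close> into a tuple of multiples of \<open>u\<close>,
  which lies in \<open>\<U>\<close>.
\<close>
lemma E_orthogonal_scaled:
  assumes u: "u \<in> (\<Inter>i. U i)" and e: "e \<in> E"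
  shows "inner (\<chi> j. (\<alpha> $ j) *\<^sub>R u) e = 0"
proof -
  obtain a where a: "a \<in> (product_set U)\<^sup>\<bottom>" and ea: "e = tensor_op Zd a"
    using e by (auto simp: E_def)
  have "inner (\<chi> j. (\<alpha> $ j) *\<^sub>R u) e = inner (tensor_op (transpose Zd) (\<chi> j. (\<alpha> $ j) *\<^sub>R u)) a"
    unfolding ea inner_tensor_op by simp
  also have "\<dots> = inner (\<chi> i. ((transpose Zd *v \<alpha>) $ i) *\<^sub>R u) a"
    by (simp only: tensor_op_scaled_vector)
  also have "\<dots> = 0"
    using u subspace_scale[OF subspace_U]
    by (intro orthogonal_compD[OF a]) (simp add: product_set_def)
  finally show ?thesis .
qed

definition ubar :: "'a ^ 'm \<Rightarrow> 'a" where
  "ubar s = (1 / (norm \<alpha>)\<^sup>2) *\<^sub>R orth_proj (\<Inter>i. U i) (tensor_adj \<alpha> s)"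

text \<open>
  The projection of \<open>s\<close> onto \<open>\<alpha>\<^sub>\<otimes> U + E\<close>, the two summands being orthogonal and the first one an image
  of \<open>U\<close> under \<open>\<parallel>\<alpha>\<parallel>\<close> times an isometry.
\<close>
definition limit :: "'a ^ 'm \<Rightarrow> 'a ^ 'm" where
  "limit s = (\<chi> j. (\<alpha> $ j) *\<^sub>R ubar s) + orth_proj E s"

lemma subspace_Inter_U: "subspace (\<Inter>i. U i)" and closed_Inter_U: "closed (\<Inter>i. U i)"
  using subspace_U closed_U by (auto intro!: subspace_Inter)

lemmas orth_proj_Inter_U = orth_proj_works[OF subspace_Inter_U closed_Inter_U]
lemmas orth_proj_E = orth_proj_works[OF subspace_E closed_E]

lemma ubar_mem: "ubar s \<in> (\<Inter>i. U i)"
  unfolding ubar_def by (intro subspace_scale[OF subspace_Inter_U] orth_proj_Inter_U)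

lemma orthogonal_comp_product_U: "(product_set U)\<^sup>\<bottom> = product_set (\<lambda>i. (U i)\<^sup>\<bottom>)"
  by (intro orthogonal_comp_product_set subspace_0 subspace_U)

lemma sweep_limit: "sweep (tensor_op Z (limit s)) = (\<chi> i. ubar s)"
proof -
  have "tensor_op Z (limit s) = (\<chi> i. (\<delta> $ i) *\<^sub>R ubar s) + tensor_op Z (orth_proj E s)"
    unfolding limit_def linear_add[OF linear_tensor_op] tensor_op_scaled_vector Z_\<alpha> ..
  moreover have "tensor_op Z (orth_proj E s) \<in> (product_set U)\<^sup>\<bottom>"
    using orth_proj_E(1) by (simp only: flip: E_iff)
  ultimately show ?thesis
    unfolding sweep_eq_constant_iff orthogonal_comp_product_U using ubar_mem[of s] by simp
qed

lemma T_limit: "T (limit s) = limit s"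
  unfolding T_fixed_iff using sweep_limit by blast

text \<open>
  At a fixed point the sweep is constant, equal to some \<open>u \<in> U\<close>, and \<open>Z f - \<delta>\<^sub>\<otimes> u \<in> \<U>\<^sup>\<bottom>\<close>. Since \<open>\<delta> = Z \<alpha>\<close>,
  this says that \<open>f - \<alpha>\<^sub>\<otimes> u \<in> E\<close>.
\<close>
lemma fixed_point_decomposition:
  assumes "T f = f"
  obtains u e where "u \<in> (\<Inter>i. U i)" "e \<in> E" "f = (\<chi> j. (\<alpha> $ j) *\<^sub>R u) + e"
proof -
  obtain u where "sweep (tensor_op Z f) = (\<chi> i. u)"
    using assms T_fixed_iff by blast
  then have u: "u \<in> (\<Inter>i. U i)"
    and a: "tensor_op Z f - (\<chi> i. (\<delta> $ i) *\<^sub>R u) \<in> (product_set U)\<^sup>\<bottom>"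
    unfolding sweep_eq_constant_iff orthogonal_comp_product_U by auto
  let ?e = "f - (\<chi> j. (\<alpha> $ j) *\<^sub>R u)"
  have "tensor_op Z ?e = tensor_op Z f - (\<chi> i. (\<delta> $ i) *\<^sub>R u)"
    unfolding linear_diff[OF linear_tensor_op] tensor_op_scaled_vector Z_\<alpha> ..
  then have "?e \<in> E"
    unfolding E_iff using a by simp
  with u show thesis
    by (intro that[of u ?e]) auto
qed

lemma limit_orthogonal:
  assumes "T f = f"
  shows "inner (s - limit s) f = 0"
proof -
  obtain u e where u: "u \<in> (\<Inter>i. U i)" and e: "e \<in> E" and f: "f = (\<chi> j. (\<alpha> $ j) *\<^sub>R u) + e"
    using fixed_point_decomposition[OF assms] .
  let ?au = "\<chi> j. (\<alpha> $ j) *\<^sub>R u" and ?ab = "\<chi> j. (\<alpha> $ j) *\<^sub>R ubar s"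
  have "inner ?au ?ab = (norm \<alpha>)\<^sup>2 * inner u (ubar s)"
    by (simp add: inner_vec_def power2_norm_eq_inner sum_distrib_right mult.assoc)
  also have "\<dots> = inner u (orth_proj (\<Inter>i. U i) (tensor_adj \<alpha> s))"
    using \<alpha>_nonzero by (simp add: ubar_def)
  also have "\<dots> = inner u (tensor_adj \<alpha> s)"
    using orthogonal_compD[OF orth_proj_Inter_U(2) u, of "tensor_adj \<alpha> s"]
    by (simp add: inner_diff_right)
  also have "\<dots> = inner ?au s"
    by (simp add: inner_tensor_adj)
  finally have "inner ?au (s - ?ab) = 0"
    by (simp add: inner_diff_right)
  moreover have "inner ?au (orth_proj E s) = 0"
    using u orth_proj_E(1) by (rule E_orthogonal_scaled)
  moreover have "inner e (s - orth_proj E s) = 0"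
    using orth_proj_E(2) e by (rule orthogonal_compD)
  moreover have "inner e ?ab = 0"
    using E_orthogonal_scaled[OF ubar_mem e] by (simp add: inner_commute)
  ultimately show ?thesis
    unfolding f limit_def inner_commute[of "s - _"]
    by (simp add: inner_add_left inner_add_right inner_diff_right)
qed

lemma T_powers_tendsto: "(\<lambda>k. (T ^^ k) s) \<longlonglongrightarrow> limit s"
  using \<theta> by (intro averaged_powers_tendsto[OF linear_T _ averaged_T T_limit limit_orthogonal]) auto

end

section \<open>Strong convergence\<close>

theorem theorem4p7:
  fixes U :: "'n::{finite,linorder} \<Rightarrow> 'a::{real_inner,complete_space} set"
    and A :: "'n \<Rightarrow> 'a \<Rightarrow> 'a set"
    and G G' :: "('n \<times> 'n) set"
    and Z :: "real ^ 'm::finite ^ 'n::{finite,linorder}"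
    and \<theta> :: real
    and x w :: "nat \<Rightarrow> 'a ^ 'n::{finite,linorder}"
    and v :: "nat \<Rightarrow> 'a ^ 'm"
    and \<delta> :: "real ^ 'n::{finite,linorder}"
    and \<alpha> :: "real ^ 'm"
    and E :: "('a ^ 'm) set"
    and ubar :: 'a
    and ebar :: "'a ^ 'm"
  assumes "\<And>i. subspace (U i)" and "\<And>i. closed (U i)"
    and "\<And>i. A i = normal_cone (U i)"
    and "algorithmic_graph G"
    and "G' \<subseteq> G" and "connected_graph G'"
    and "CARD('m) = CARD('n) - 1"
    and "Lap G' = Z ** transpose Z"
    and "0 < \<theta>" and "\<theta> < 2"
    and "\<And>k i. resolvent (scale_op (1 / real (deg G i)) (A i))
           ((real (deg G' i) / real (deg G i)) *\<^sub>R (w k $ i)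
            - (1 / real (deg G i)) *\<^sub>R (\<Sum>h | (i, h) \<in> G'. w k $ h)
            - (1 / real (deg G i)) *\<^sub>R (\<Sum>h | (h, i) \<in> G'. w k $ h)
            + (1 / real (deg G i)) *\<^sub>R (\<Sum>j\<in>UNIV. (Z $ i $ j) *\<^sub>R (v k $ j))
            + (2 / real (deg G i)) *\<^sub>R (\<Sum>h | (h, i) \<in> G. x (Suc k) $ h))
         = {x (Suc k) $ i}"
    and "\<And>k i. w (Suc k) $ i = (1 - \<theta>) *\<^sub>R (w k $ i) + \<theta> *\<^sub>R (x (Suc k) $ i)"
    and "\<And>k i. v (Suc k) $ i
         = v k $ i + \<theta> *\<^sub>R (\<Sum>j\<in>UNIV. (Z $ j $ i) *\<^sub>R (w k $ j - 2 *\<^sub>R (x (Suc k) $ j)))"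
    and "\<delta> = degree_balance G"
    and "\<alpha> = moore_penrose Z *v \<delta>"
    and "E = tensor_op (moore_penrose Z) ` ((product_set U)\<^sup>\<bottom> \<inter> diagonal\<^sup>\<bottom>)"
    and "ubar = (1 / (norm \<alpha>)\<^sup>2) *\<^sub>R
           orth_proj (\<Inter>i. U i) (tensor_adj \<alpha> (tensor_op (transpose Z) (w 0) + v 0))"
    and "ebar = orth_proj E (tensor_op (transpose Z) (w 0) + v 0)"
  shows "ubar = (1 / (norm \<alpha>)\<^sup>2) *\<^sub>R
           orth_proj (\<Inter>i. U i) (tensor_adj \<delta> (w 0) + tensor_adj \<alpha> (v 0))
       \<and> (\<forall>i. (\<lambda>k. x k $ i) \<longlonglongrightarrow> ubar \<and> (\<lambda>k. w k $ i) \<longlonglongrightarrow> ubar)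
       \<and> (\<forall>i. (\<lambda>k. v k $ i) \<longlonglongrightarrow> (\<alpha> $ i) *\<^sub>R ubar + ebar $ i)"
proof -
  note res = assms(11) and w_step = assms(12) and v_step = assms(13)
  interpret P: graph_splitting U G G' Z \<theta>
    by unfold_locales (use assms in auto)
  have \<delta>: "\<delta> = P.\<delta>" and \<alpha>: "\<alpha> = P.\<alpha>" and E: "E = P.E"
    using assms by (simp_all add: P.\<alpha>_def P.E_def)
  define s where "s k = tensor_op (transpose Z) (w k) + v k" for k
  have ubar: "ubar = P.ubar (s 0)"
    using assms by (simp add: P.ubar_def s_def \<alpha>)
  have ebar: "ebar = orth_proj P.E (s 0)"
    using assms by (simp add: s_def E)
  have lim_nth: "P.limit (s 0) $ j = (\<alpha> $ j) *\<^sub>R ubar + ebar $ j" for j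
    by (simp add: P.limit_def \<alpha> ubar ebar)

  have x_step: "x (Suc k) = P.sweep (tensor_op Z (s k))" for k
  proof (rule P.sweep_eqI[symmetric])
    show "P.solution (tensor_op Z (s k)) (x (Suc k))"
      unfolding P.solution_def
    proof (intro allI conjI)
      fix i
      let ?d = "real (deg G i)"
      let ?y = "(real (deg G' i) / ?d) *\<^sub>R (w k $ i)
            - (1 / ?d) *\<^sub>R (\<Sum>h | (i, h) \<in> G'. w k $ h)
            - (1 / ?d) *\<^sub>R (\<Sum>h | (h, i) \<in> G'. w k $ h)
            + (1 / ?d) *\<^sub>R (\<Sum>j\<in>UNIV. (Z $ i $ j) *\<^sub>R (v k $ j))
            + (2 / ?d) *\<^sub>R (\<Sum>h | (h, i) \<in> G. x (Suc k) $ h)"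
      have "resolvent (scale_op (1 / ?d) (normal_cone (U i))) ?y = {x (Suc k) $ i}"
        using res[of i k] assms(3) by simp
      note proj = resolvent_normal_coneD[OF P.subspace_U this]
      show "x (Suc k) $ i \<in> U i"
        by (rule proj)
      have "tensor_op Z (s k) = tensor_op (Lap G') (w k) + tensor_op Z (v k)"
        by (simp only: s_def linear_add[OF linear_tensor_op] P.factor tensor_op_matrix_mult)
      then have "tensor_op Z (s k) $ i = tensor_op (Lap G') (w k) $ i + tensor_op Z (v k) $ i"
        by (simp only: vector_add_component)
      then have "tensor_op Z (s k) $ i + 2 *\<^sub>R (\<Sum>h | (h, i) \<in> G. x (Suc k) $ h) = ?d *\<^sub>R ?y"
        using P.degree_pos[of i]
        by (simp only: tensor_op_Lap[OF P.asym_G'])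
          (simp add: scaleR_add_right scaleR_diff_right)
      then show "tensor_op Z (s k) $ i + 2 *\<^sub>R (\<Sum>h | (h, i) \<in> G. x (Suc k) $ h)
          - ?d *\<^sub>R x (Suc k) $ i \<in> (U i)\<^sup>\<bottom>"
        using subspace_scale[OF subspace_orthogonal_comp proj(2), of ?d]
        by (simp only: scaleR_diff_right[of ?d ?y])
    qed
  qed

  \<comment> \<open>The terms in \<open>Z\<^sup>* w\<close> cancel in the update of \<open>Z\<^sup>* w + v\<close>, so that \<open>s\<close> evolves autonomously.\<close>
  have w_vec: "w (Suc k) = (1 - \<theta>) *\<^sub>R w k + \<theta> *\<^sub>R x (Suc k)" for k
    using w_step by (simp add: vec_eq_iff)
  have v_vec: "v (Suc k) = v k + \<theta> *\<^sub>R tensor_op (transpose Z) (w k - 2 *\<^sub>R x (Suc k))" for k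
    using v_step by (simp add: vec_eq_iff transpose_def)
  have two: "\<theta> *\<^sub>R 2 *\<^sub>R g = \<theta> *\<^sub>R g + \<theta> *\<^sub>R g" for g :: "('a, 'm) vec"
    by (metis scaleR_2 scaleR_add_right)
  have "s (Suc k) = P.T (s k)" for k
  proof -
    have "s (Suc k) = s k - \<theta> *\<^sub>R tensor_op (transpose Z) (x (Suc k))"
      unfolding s_def w_vec v_vec linear_add[OF linear_tensor_op] linear_diff[OF linear_tensor_op]
        linear_cmul[OF linear_tensor_op]
      by (simp add: algebra_simps two del: scaleR_scaleR)
    then show ?thesis
      by (simp add: P.T_def x_step)
  qed
  then have s_pow: "s k = (P.T ^^ k) (s 0)" for k
    by (induction k) simp_all
  have s_lim: "s \<longlonglongrightarrow> P.limit (s 0)"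
    using P.T_powers_tendsto[of "s 0"] by (simp only: flip: s_pow)

  let ?u = "\<chi> i. ubar"
  have "(\<lambda>k. x (Suc k)) \<longlonglongrightarrow> P.sweep (tensor_op Z (P.limit (s 0)))"
    unfolding x_step by (intro P.sweep_tendsto tendsto_tensor_op s_lim)
  then have x_Suc_lim: "(\<lambda>k. x (Suc k)) \<longlonglongrightarrow> ?u"
    by (simp only: P.sweep_limit ubar)
  then have x_lim: "x \<longlonglongrightarrow> ?u"
    by (rule LIMSEQ_imp_Suc)
  have "(\<lambda>k. w k - ?u) \<longlonglongrightarrow> 0"
  proof (rule contraction_recurrence_tendsto_0)
    show "w (Suc k) - ?u = (1 - \<theta>) *\<^sub>R (w k - ?u) + \<theta> *\<^sub>R (x (Suc k) - ?u)" for k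
      unfolding w_vec by (simp add: algebra_simps)
    show "\<bar>1 - \<theta>\<bar> < 1"
      using P.\<theta> by auto
    have "(\<lambda>k. \<theta> *\<^sub>R (x (Suc k) - ?u)) \<longlonglongrightarrow> \<theta> *\<^sub>R (?u - ?u)"
      by (intro tendsto_intros x_Suc_lim)
    then show "(\<lambda>k. \<theta> *\<^sub>R (x (Suc k) - ?u)) \<longlonglongrightarrow> 0"
      by simp
  qed
  then have w_lim: "w \<longlonglongrightarrow> ?u"
    by (rule LIM_zero_cancel)
  have "(\<lambda>k. s k - tensor_op (transpose Z) (w k)) \<longlonglongrightarrow> P.limit (s 0) - tensor_op (transpose Z) ?u"
    by (intro tendsto_diff s_lim tendsto_tensor_op w_lim)
  moreover have "tensor_op (transpose Z) ?u = 0"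
    using P.ker_Zt[of ?u] by blast
  moreover have "(\<lambda>k. s k - tensor_op (transpose Z) (w k)) = v"
    by (simp add: s_def fun_eq_iff)
  ultimately have v_lim: "v \<longlonglongrightarrow> P.limit (s 0)"
    by (simp only: diff_zero)

  have "tensor_adj \<alpha> (tensor_op (transpose Z) (w 0) + v 0) = tensor_adj \<delta> (w 0) + tensor_adj \<alpha> (v 0)"
    by (simp only: tensor_adj_add tensor_adj_tensor_op \<alpha> \<delta> P.Z_\<alpha>)
  then have "ubar = (1 / (norm \<alpha>)\<^sup>2) *\<^sub>R
      orth_proj (\<Inter>i. U i) (tensor_adj \<delta> (w 0) + tensor_adj \<alpha> (v 0))"
    using assms by simp
  moreover have "(\<lambda>k. x k $ i) \<longlonglongrightarrow> ubar" "(\<lambda>k. w k $ i) \<longlonglongrightarrow> ubar" for i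
    using tendsto_vec_nth[OF x_lim, of i] tendsto_vec_nth[OF w_lim, of i] by simp_all
  moreover have "(\<lambda>k. v k $ i) \<longlonglongrightarrow> (\<alpha> $ i) *\<^sub>R ubar + ebar $ i" for i
    using tendsto_vec_nth[OF v_lim, of i] by (simp only: lim_nth)
  ultimately show ?thesis
    by blast
qed

end
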